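(* Let $a\in\mathbb{R}$ and $\lambda>0$, and for $k=0,1,2,\ldots$ let $\psi_k$ be the eigenfunction of the eigenvalue problem $$-\psi''(x)+\Big(ax^2+\frac{\lambda}{2}x^4\Big)\psi(x)=E\psi(x),\quad x\in\mathbb{R},\qquad \lim_{x\to\pm\infty}\psi(x)=0,$$ belonging to the $k$-th eigenvalue $E_k$ (where $E_0<E_1<\cdots$), normalised by $$\psi_k(x)\sim x^{-1}\exp\Big(-\frac{(\lambda/2)^{1/2}}{3}x^3-\frac{a}{2(\lambda/2)^{1/2}}x\Big),\quad x\to+\infty.$$ Define $$\mathcal{K}(a,\lambda;x,y,z)=\lambda^{1/3}\exp\big((\lambda/2)^{1/2}xyz\big)\,\mathrm{Ai}\Big(\frac{\lambda^{1/3}}{2}(x^2+y^2+z^2)+\frac{a}{\lambda^{2/3}}\Big).$$ Then for every $k=0,1,2,\ldots$ and all $x,y\in\mathbb{R}$, $$\psi_k(x)\psi_k(y)=\int_{\mathbb{R}}\psi_k(z)\,\mathcal{K}(a,\lambda;x,y,z)\,dz.$$ Moreover, if $a>\lambda^{2/3}a_1$, where $a_1=-2.3381074105\ldots$ is the first (largest) zero of $\mathrm{Ai}$, then $\mathcal{K}(a,\lambda;x,y,z)>0$ for all $x,y,z\in\mathbb{R}$.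
   Context: $\mathrm{Ai}$ denotes the standard Airy function, the solution of $w''(x)=xw(x)$ given by $\mathrm{Ai}(x)=\frac{1}{2\pi i}\int_{\infty e^{-i\pi/3}}^{\infty e^{i\pi/3}}\exp(\zeta^3/3-\zeta x)\,d\zeta$. The eigenvalue problem stated has a discrete spectrum of real simple eigenvalues $E_0<E_1<\cdots\to\infty$; for each $E_k$ there is a unique solution with the stated asymptotic behaviour as $x\to+\infty$ (its derivative having the asymptotics given by differentiating the right-hand side), and this is $\psi_k$. *)

theory Defs
  imports "HOL-Analysis.Analysis" "HOL-Library.Landau_Symbols"
begin

text \<open>Airy function, defined by the contour integral
  Ai(x) = 1/(2 pi i) int_{infty e^{-i pi/3}}^{infty e^{i pi/3}} exp(zeta^3/3 - zeta x) d zeta,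
  where the contour is the two rays through the origin, parametrised as
  zeta = r cis(-pi/3) (r from infinity down to 0) followed by zeta = r cis(pi/3)
  (r from 0 to infinity).\<close>

definition airy_integrand :: "real \<Rightarrow> complex \<Rightarrow> complex" where
  "airy_integrand x \<zeta> = exp (\<zeta> ^ 3 / 3 - \<zeta> * complex_of_real x)"

definition Airy_Ai :: "real \<Rightarrow> real" where
  "Airy_Ai x = Re ((1 / (2 * complex_of_real pi * \<i>)) *
     ((LINT r:{0..}|lborel. airy_integrand x (complex_of_real r * cis (pi/3)) * cis (pi/3))
    - (LINT r:{0..}|lborel. airy_integrand x (complex_of_real r * cis (-(pi/3))) * cis (-(pi/3)))))"

definition airy_a1 :: real where
  "airy_a1 = (GREATEST t. Airy_Ai t = 0)"

definition quartic_kernel :: "real \<Rightarrow> real \<Rightarrow> real \<Rightarrow> real \<Rightarrow> real \<Rightarrow> real" where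
  "quartic_kernel a lam x y z =
     lam powr (1/3) * exp (sqrt (lam/2) * x * y * z) *
     Airy_Ai (lam powr (1/3) / 2 * (x^2 + y^2 + z^2) + a / lam powr (2/3))"

definition normalised_eigenfunction :: "real \<Rightarrow> real \<Rightarrow> real \<Rightarrow> (real \<Rightarrow> real) \<Rightarrow> bool" where
  "normalised_eigenfunction a lam E \<psi> \<longleftrightarrow>
     (\<exists>\<psi>'. \<forall>x. (\<psi> has_real_derivative \<psi>' x) (at x) \<and>
        (\<psi>' has_real_derivative ((a * x^2 + lam/2 * x^4 - E) * \<psi> x)) (at x)) \<and>
     (\<psi> \<longlongrightarrow> 0) at_top \<and> (\<psi> \<longlongrightarrow> 0) at_bot \<and>
     \<psi> \<sim>[at_top] (\<lambda>x. inverse x *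
        exp (- (sqrt (lam/2) / 3) * x^3 - a / (2 * sqrt (lam/2)) * x))"

end

theory Submission
  imports Defs "HOL-Complex_Analysis.Cauchy_Integral_Theorem" "HOL-Probability.Distributions"
    "HOL-Real_Asymp.Real_Asymp"
begin

text \<open>Write \<open>\<lambda> = 8 b\<^sup>6\<close> and fix \<open>x\<close>. The kernel satisfies
  \<open>(\<partial>\<^sub>y\<^sup>2 - V y) \<K> = (\<partial>\<^sub>z\<^sup>2 - V z) \<K>\<close>, so integration by parts shows that
  \<open>F y = \<integral> \<psi> z \<K> x y z dz\<close> solves the same equation as \<open>\<psi>\<close>. Moving the Airy contour to
  \<open>Re \<zeta> = b y\<close> turns \<open>\<K> x y z\<close> exactly into the normalising function of \<open>\<psi> y\<close> times an approximate
  identity \<open>exp (- b\<^sup>3 y (z - x)\<^sup>2)\<close>, whence \<open>F y / \<psi> y\<close> tends to \<open>\<psi> x\<close> as \<open>y\<close> tends to infinity.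
  A solution with this property is \<open>\<psi> x\<close> times \<open>\<psi>\<close>. Positivity of the kernel follows from continuity
  of the Airy function and its positivity near infinity.\<close>

subsection \<open>Calculus on the real line\<close>

lemma bounded_range_if_tendsto_at_top_at_bot:
  fixes f :: "real \<Rightarrow> 'a::real_normed_vector"
  assumes "continuous_on UNIV f" "(f \<longlongrightarrow> l) at_top" "(f \<longlongrightarrow> m) at_bot"
  shows "bounded (range f)"
proof -
  obtain p where "\<And>z. z \<ge> p \<Longrightarrow> dist (f z) l < 1"
    using tendstoD[OF assms(2), of 1] by (auto simp: eventually_at_top_linorder)
  then have "bounded (f ` {p..})"
    by (intro bounded_subset[OF bounded_ball[of l 1]]) (auto simp: dist_commute)
  moreover obtain q where "\<And>z. z \<le> q \<Longrightarrow> dist (f z) m < 1"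
    using tendstoD[OF assms(3), of 1] by (auto simp: eventually_at_bot_linorder)
  then have "bounded (f ` {..q})"
    by (intro bounded_subset[OF bounded_ball[of m 1]]) (auto simp: dist_commute)
  moreover have "bounded (f ` {q..p})"
    using continuous_on_subset[OF assms(1)] by (intro compact_imp_bounded compact_continuous_image) auto
  ultimately have "bounded (f ` ({p..} \<union> {..q} \<union> {q..p}))"
    unfolding image_Un by simp
  moreover have "{p..} \<union> {..q} \<union> {q..p} = UNIV"
    by auto
  ultimately show ?thesis by simp
qed

lemma integral_FTC_real_line:
  fixes f F :: "real \<Rightarrow> 'a::euclidean_space"
  assumes "\<And>x. (F has_vector_derivative f x) (at x)"
    and "continuous_on UNIV f" "integrable lborel f"
    and "(F \<longlongrightarrow> A) at_bot" "(F \<longlongrightarrow> B) at_top"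
  shows "(\<integral>x. f x \<partial>lborel) = B - A"
proof -
  have "(LBINT x=-\<infinity>..\<infinity>. f x) = B - A"
  proof (rule interval_integral_FTC_integrable)
    show "isCont f x" for x using assms(2) by (simp add: continuous_on_eq_continuous_at)
    show "set_integrable lborel (einterval (-\<infinity>) \<infinity>) f"
      using assms(3) by (simp add: set_integrable_def)
    show "((F \<circ> real_of_ereal) \<longlongrightarrow> A) (at_right (-\<infinity>))" "((F \<circ> real_of_ereal) \<longlongrightarrow> B) (at_left \<infinity>)"
      using assms(4,5) by (simp_all add: ereal_tendsto_simps)
  qed (auto intro: assms(1))
  then show ?thesis
    by (simp add: interval_lebesgue_integral_def set_lebesgue_integral_def)
qed

lemma integral_second_derivative_symmetric:
  fixes u v :: "real \<Rightarrow> real"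
  assumes deriv:
      "\<And>z. (u has_real_derivative u' z) (at z)" "\<And>z. (u' has_real_derivative u'' z) (at z)"
      "\<And>z. (v has_real_derivative v' z) (at z)" "\<And>z. (v' has_real_derivative v'' z) (at z)"
    and cont: "continuous_on UNIV u''" "continuous_on UNIV v''"
    and int: "integrable lborel (\<lambda>z. u z * v'' z)" "integrable lborel (\<lambda>z. u'' z * v z)"
    and lim: "\<And>F. F = at_top \<or> F = at_bot \<Longrightarrow> ((\<lambda>z. u z * v' z) \<longlongrightarrow> 0) F"
      "\<And>F. F = at_top \<or> F = at_bot \<Longrightarrow> ((\<lambda>z. u' z * v z) \<longlongrightarrow> 0) F"
  shows "(\<integral>z. u z * v'' z \<partial>lborel) = (\<integral>z. u'' z * v z \<partial>lborel)"
proof -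
  let ?W = "\<lambda>z. u z * v' z - u' z * v z"
  have "(\<integral>z. u z * v'' z - u'' z * v z \<partial>lborel) = 0 - 0"
  proof (rule integral_FTC_real_line)
    show "(?W has_vector_derivative u z * v'' z - u'' z * v z) (at z)" for z
      unfolding has_real_derivative_iff_has_vector_derivative[symmetric]
      by (rule derivative_eq_intros deriv refl)+ (simp add: algebra_simps)
    have "continuous_on UNIV u" "continuous_on UNIV v"
      by (rule DERIV_continuous_on, rule DERIV_subset, rule deriv, simp)+
    then show "continuous_on UNIV (\<lambda>z. u z * v'' z - u'' z * v z)"
      by (intro continuous_intros cont)
    show "(?W \<longlongrightarrow> 0) at_bot" "(?W \<longlongrightarrow> 0) at_top"
      using tendsto_diff[OF lim] by force+
  qed (use int in simp)
  then show ?thesis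
    using int by simp
qed

lemma has_vector_derivative_iff:
  fixes f :: "real \<Rightarrow> 'a::real_normed_vector"
  shows "(f has_vector_derivative D) (at x within S) \<longleftrightarrow>
    ((\<lambda>y. (f y - f x) /\<^sub>R (y - x)) \<longlongrightarrow> D) (at x within S)"
proof -
  have quotient: "norm (f y - f x - (y - x) *\<^sub>R D) / norm (y - x) = norm ((f y - f x) /\<^sub>R (y - x) - D)"
    if "y \<noteq> x" for y
  proof -
    have "f y - f x - (y - x) *\<^sub>R D = (y - x) *\<^sub>R ((f y - f x) /\<^sub>R (y - x) - D)"
      using that by (simp add: scaleR_diff_right)
    then show ?thesis using that by simp
  qed
  have "(f has_vector_derivative D) (at x within S) \<longleftrightarrow>
      ((\<lambda>y. norm (f y - f x - (y - x) *\<^sub>R D) / norm (y - x)) \<longlongrightarrow> 0) (at x within S)"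
    by (simp add: has_vector_derivative_def has_derivative_iff_norm bounded_linear_scaleR_left)
  also have "\<dots> \<longleftrightarrow> ((\<lambda>y. norm ((f y - f x) /\<^sub>R (y - x) - D)) \<longlongrightarrow> 0) (at x within S)"
    by (intro tendsto_cong) (auto simp: eventually_at_filter quotient simp del: real_norm_def)
  also have "\<dots> \<longleftrightarrow> ((\<lambda>y. (f y - f x) /\<^sub>R (y - x)) \<longlongrightarrow> D) (at x within S)"
    by (simp only: tendsto_norm_zero_iff LIM_zero_iff)
  finally show ?thesis .
qed

lemma norm_difference_quotient_le:
  fixes f :: "real \<Rightarrow> 'a::real_normed_vector"
  assumes "convex S" "x \<in> S" "y \<in> S"
    and deriv: "\<And>t. t \<in> S \<Longrightarrow> (f has_vector_derivative f' t) (at t within S)"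
    and bound: "\<And>t. t \<in> S \<Longrightarrow> norm (f' t) \<le> B"
  shows "norm ((f y - f x) /\<^sub>R (y - x)) \<le> B"
proof -
  have "norm (f y - f x) \<le> B * norm (y - x)"
  proof (rule differentiable_bound[OF assms(1) _ _ assms(3,2)])
    show "(f has_derivative (\<lambda>h. h *\<^sub>R f' t)) (at t within S)" if "t \<in> S" for t
      using deriv[OF that] by (simp add: has_vector_derivative_def)
    show "onorm (\<lambda>h. h *\<^sub>R f' t) \<le> B" if "t \<in> S" for t
      using bound[OF that] by (intro onorm_le) (simp add: mult.commute[of _ "\<bar>_\<bar>"] mult_left_mono)
  qed
  moreover have "0 \<le> B"
    using bound[OF assms(2)] norm_ge_zero order_trans by blast
  ultimately show ?thesis
    by (cases "y = x") (simp_all add: divide_simps mult.commute)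
qed

proposition has_vector_derivative_lebesgue_integral:
  fixes f :: "real \<Rightarrow> 'a \<Rightarrow> 'b::{banach,second_countable_topology}"
  assumes S: "convex S" "y \<in> S"
    and deriv: "\<And>t z. t \<in> S \<Longrightarrow> ((\<lambda>t. f t z) has_vector_derivative f' t z) (at t within S)"
    and int: "\<And>t. t \<in> S \<Longrightarrow> integrable M (f t)"
    and meas: "f' y \<in> borel_measurable M"
    and bound: "\<And>t z. t \<in> S \<Longrightarrow> norm (f' t z) \<le> g z" "integrable M g"
  shows "((\<lambda>t. \<integral>z. f t z \<partial>M) has_vector_derivative (\<integral>z. f' y z \<partial>M)) (at y within S)"
  unfolding has_vector_derivative_iff tendsto_at_iff_sequentially comp_def
proof (intro allI impI)
  fix X :: "nat \<Rightarrow> real"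
  assume X: "\<forall>n. X n \<in> S - {y}" "X \<longlonglongrightarrow> y"
  have "(\<lambda>n. \<integral>z. (f (X n) z - f y z) /\<^sub>R (X n - y) \<partial>M) \<longlonglongrightarrow> (\<integral>z. f' y z \<partial>M)"
  proof (rule integral_dominated_convergence[OF meas _ bound(2)])
    show "(\<lambda>z. (f (X n) z - f y z) /\<^sub>R (X n - y)) \<in> borel_measurable M" for n
      using X(1) S(2) int by (intro borel_measurable_integrable integrable_scaleR_right
          Bochner_Integration.integrable_diff) auto
    show "AE z in M. (\<lambda>n. (f (X n) z - f y z) /\<^sub>R (X n - y)) \<longlonglongrightarrow> f' y z"
      using deriv[OF S(2)] X unfolding has_vector_derivative_iff tendsto_at_iff_sequentially comp_def
      by (intro AE_I2) blast
    show "AE z in M. norm ((f (X n) z - f y z) /\<^sub>R (X n - y)) \<le> g z" for n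
      using X(1) by (intro AE_I2 norm_difference_quotient_le[OF S _ deriv bound(1)]) auto
  qed
  moreover have X_in: "X n \<in> S" for n
    using X(1) by simp
  have "(\<integral>z. (f (X n) z - f y z) /\<^sub>R (X n - y) \<partial>M) =
      ((\<integral>z. f (X n) z \<partial>M) - (\<integral>z. f y z \<partial>M)) /\<^sub>R (X n - y)" for n
    by (simp only: integral_scaleR_right Bochner_Integration.integral_diff[OF int[OF X_in] int[OF S(2)]])
  ultimately show "(\<lambda>n. ((\<integral>z. f (X n) z \<partial>M) - (\<integral>z. f y z \<partial>M)) /\<^sub>R (X n - y)) \<longlonglongrightarrow> (\<integral>z. f' y z \<partial>M)"
    by (simp only:)
qed

subsection \<open>Linear second-order equations\<close>

lemma linear_ode_energy_mono:
  fixes u u' p :: "real \<Rightarrow> real"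
  assumes u: "\<And>r. (u has_real_derivative u' r) (at r)" "\<And>r. (u' has_real_derivative p r * u r) (at r)"
    and p: "\<And>r. r \<in> {s..t} \<Longrightarrow> \<bar>p r\<bar> \<le> M" and "s \<le> t"
  shows "exp ((1 + M) * s) * ((u s)\<^sup>2 + (u' s)\<^sup>2) \<le> exp ((1 + M) * t) * ((u t)\<^sup>2 + (u' t)\<^sup>2)"
proof (rule DERIV_nonneg_imp_nondecreasing[OF \<open>s \<le> t\<close>])
  fix r assume r: "s \<le> r" "r \<le> t"
  let ?d = "exp ((1 + M) * r) * ((1 + M) * ((u r)\<^sup>2 + (u' r)\<^sup>2) + (1 + p r) * (2 * u r * u' r))"
  have "((\<lambda>r. exp ((1 + M) * r) * ((u r)\<^sup>2 + (u' r)\<^sup>2)) has_real_derivative ?d) (at r)"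
    by (rule derivative_eq_intros u refl | simp)+ (simp add: power2_eq_square algebra_simps)
  moreover have "\<bar>1 + p r\<bar> * \<bar>2 * u r * u' r\<bar> \<le> (1 + M) * ((u r)\<^sup>2 + (u' r)\<^sup>2)"
  proof (rule mult_mono)
    show "\<bar>1 + p r\<bar> \<le> 1 + M" using p[of r] r by auto
    then show "0 \<le> 1 + M" by linarith
    show "\<bar>2 * u r * u' r\<bar> \<le> (u r)\<^sup>2 + (u' r)\<^sup>2"
      using sum_squares_bound[of "\<bar>u r\<bar>" "\<bar>u' r\<bar>"] by (simp add: abs_mult)
  qed simp
  then have "0 \<le> ?d"
    unfolding abs_mult[symmetric] by (intro mult_nonneg_nonneg) auto
  ultimately show "\<exists>d. ((\<lambda>r. exp ((1 + M) * r) * ((u r)\<^sup>2 + (u' r)\<^sup>2)) has_real_derivative d) (at r) \<and> 0 \<le> d"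
    by blast
qed

lemma linear_ode_zero_left:
  fixes u u' p :: "real \<Rightarrow> real"
  assumes u: "\<And>r. (u has_real_derivative u' r) (at r)" "\<And>r. (u' has_real_derivative p r * u r) (at r)"
    and p: "continuous_on UNIV p" and zero: "u t = 0" "u' t = 0" and "s \<le> t"
  shows "u s = 0"
proof -
  have "bounded (p ` {s..t})"
    using p by (intro compact_imp_bounded compact_continuous_image) (auto intro: continuous_on_subset)
  then obtain M where "\<And>r. r \<in> {s..t} \<Longrightarrow> \<bar>p r\<bar> \<le> M"
    by (metis bounded_iff imageI real_norm_def)
  from linear_ode_energy_mono[OF u this \<open>s \<le> t\<close>]
  have "(u s)\<^sup>2 + (u' s)\<^sup>2 \<le> 0"
    by (simp add: zero mult_le_0_iff)
  then show ?thesis by (simp add: sum_power2_le_zero_iff)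
qed

lemma linear_ode_zero:
  fixes u u' p :: "real \<Rightarrow> real"
  assumes u: "\<And>r. (u has_real_derivative u' r) (at r)" "\<And>r. (u' has_real_derivative p r * u r) (at r)"
    and p: "continuous_on UNIV p" and zero: "u t = 0" "u' t = 0"
  shows "u s = 0"
proof (cases "s \<le> t")
  case True
  then show ?thesis by (rule linear_ode_zero_left[OF u p zero])
next
  case False
  have "u (- (- s)) = 0"
  proof (rule linear_ode_zero_left[where u = "\<lambda>r. u (- r)" and u' = "\<lambda>r. - u' (- r)" and
        p = "\<lambda>r. p (- r)" and t = "- t"])
    show "((\<lambda>r. u (- r)) has_real_derivative - u' (- r)) (at r)" for r
      using u(1)[of "- r"] by (simp add: DERIV_mirror)
    show "((\<lambda>r. - u' (- r)) has_real_derivative p (- r) * u (- r)) (at r)" for r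
      using DERIV_minus[OF u(2)[of "- r", unfolded DERIV_mirror]] by simp
    show "continuous_on UNIV (\<lambda>r. p (- r))"
      by (intro continuous_on_compose2[OF p] continuous_intros) auto
  qed (use zero False in auto)
  then show ?thesis by simp
qed

lemma linear_ode_wronskian_constant:
  fixes u v p :: "real \<Rightarrow> real"
  assumes "\<And>y. (u has_real_derivative u' y) (at y)" "\<And>y. (u' has_real_derivative p y * u y) (at y)"
    and "\<And>y. (v has_real_derivative v' y) (at y)" "\<And>y. (v' has_real_derivative p y * v y) (at y)"
  shows "u' y * v y - u y * v' y = u' t * v t - u t * v' t"
proof -
  have "\<forall>y. ((\<lambda>y. u' y * v y - u y * v' y) has_real_derivative 0) (at y)"
    by (intro allI) (rule derivative_eq_intros assms refl | simp)+
  then show ?thesis by (rule DERIV_isconst_all)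
qed

lemma derivative_lower_bound_nonpos_if_tendsto:
  fixes q :: "real \<Rightarrow> real"
  assumes lim: "(q \<longlongrightarrow> l) at_top"
    and deriv: "\<And>y. y \<ge> Y \<Longrightarrow> (q has_real_derivative q' y) (at y)" "\<And>y. y \<ge> Y \<Longrightarrow> c \<le> \<bar>q' y\<bar>"
  shows "c \<le> 0"
proof -
  have "c \<le> \<bar>q (y + 1) - q y\<bar>" if "y \<ge> Y" for y
  proof -
    have "\<exists>s>y. s < y + 1 \<and> q (y + 1) - q y = (y + 1 - y) * q' s"
      by (rule MVT2) (use deriv(1) that in auto)
    then obtain s where "s > y" "q (y + 1) - q y = q' s" by auto
    then show ?thesis using deriv(2)[of s] that by simp
  qed
  then have "eventually (\<lambda>y. c \<le> \<bar>q (y + 1) - q y\<bar>) at_top"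
    using eventually_at_top_linorder by blast
  moreover have "((\<lambda>y. q (y + 1)) \<longlongrightarrow> l) at_top"
    by (rule filterlim_compose[OF lim]) real_asymp
  then have "((\<lambda>y. \<bar>q (y + 1) - q y\<bar>) \<longlongrightarrow> 0) at_top"
    using tendsto_diff[OF _ lim] by (intro tendsto_rabs_zero) fastforce
  ultimately show ?thesis
    using tendsto_lowerbound trivial_limit_at_top_linorder by blast
qed

text \<open>The Wronskian of \<open>u\<close> and \<open>v\<close> is constant; were it non-zero, the slope of \<open>u / v\<close> would stay
  away from 0 and the quotient could not converge.\<close>

lemma linear_ode_wronskian_eq_0_if_quotient_tendsto:
  fixes u v p :: "real \<Rightarrow> real"
  assumes u: "\<And>y. (u has_real_derivative u' y) (at y)" "\<And>y. (u' has_real_derivative p y * u y) (at y)"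
    and v: "\<And>y. (v has_real_derivative v' y) (at y)" "\<And>y. (v' has_real_derivative p y * v y) (at y)"
    and v_small: "(v \<longlongrightarrow> 0) at_top" and v_ne: "eventually (\<lambda>y. v y \<noteq> 0) at_top"
    and lim: "((\<lambda>y. u y / v y) \<longlongrightarrow> l) at_top"
  shows "u' t * v t - u t * v' t = 0"
proof -
  define W where "W = u' t * v t - u t * v' t"
  have wronskian: "u' y * v y - u y * v' y = W" for y
    unfolding W_def by (rule linear_ode_wronskian_constant[OF u v])
  have "eventually (\<lambda>y. v y \<noteq> 0 \<and> \<bar>v y\<bar> < 1) at_top"
    using v_ne order_tendstoD(2)[OF tendsto_rabs_zero[OF v_small], of 1] by (simp add: eventually_conj_iff)
  then obtain Y where Y: "\<And>y. y \<ge> Y \<Longrightarrow> v y \<noteq> 0" "\<And>y. y \<ge> Y \<Longrightarrow> \<bar>v y\<bar> < 1"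
    by (auto simp: eventually_at_top_linorder)
  have "\<bar>W\<bar> \<le> 0"
  proof (rule derivative_lower_bound_nonpos_if_tendsto[OF lim])
    show "((\<lambda>y. u y / v y) has_real_derivative W / (v y)\<^sup>2) (at y)" if "y \<ge> Y" for y
      using Y(1)[OF that]
      by (auto intro!: derivative_eq_intros u v simp: wronskian[of y, symmetric] power2_eq_square)
    show "\<bar>W\<bar> \<le> \<bar>W / (v y)\<^sup>2\<bar>" if "y \<ge> Y" for y
    proof -
      have "0 < (v y)\<^sup>2" "(v y)\<^sup>2 \<le> 1"
        using Y[OF that] by (simp_all add: abs_square_le_1)
      then show ?thesis by (simp add: le_divide_eq mult_left_le)
    qed
  qed
  then show ?thesis by (simp add: W_def)
qed

lemma linear_ode_proportional_if_wronskian_eq_0: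
  fixes u v p :: "real \<Rightarrow> real"
  assumes u: "\<And>y. (u has_real_derivative u' y) (at y)" "\<And>y. (u' has_real_derivative p y * u y) (at y)"
    and v: "\<And>y. (v has_real_derivative v' y) (at y)" "\<And>y. (v' has_real_derivative p y * v y) (at y)"
    and p: "continuous_on UNIV p"
    and wronskian: "u' t * v t - u t * v' t = 0" and "v t \<noteq> 0"
  shows "u y = u t / v t * v y"
proof -
  let ?r = "u t / v t"
  have "u y - ?r * v y = 0"
  proof (rule linear_ode_zero[where u = "\<lambda>y. u y - ?r * v y" and t = t, OF _ _ p])
    show "((\<lambda>y. u y - ?r * v y) has_real_derivative u' y - ?r * v' y) (at y)" for y
      by (intro derivative_intros u DERIV_cmult v)
    show "((\<lambda>y. u' y - ?r * v' y) has_real_derivative p y * (u y - ?r * v y)) (at y)" for y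
      by (rule derivative_eq_intros u v refl)+ (simp add: algebra_simps)
    show "u t - ?r * v t = 0" "u' t - ?r * v' t = 0"
      using wronskian \<open>v t \<noteq> 0\<close> by (simp_all add: field_simps)
  qed
  then show ?thesis by simp
qed

proposition linear_ode_solution_eq_if_asymptotic:
  fixes u v p :: "real \<Rightarrow> real"
  assumes u: "\<And>y. (u has_real_derivative u' y) (at y)" "\<And>y. (u' has_real_derivative p y * u y) (at y)"
    and v: "\<And>y. (v has_real_derivative v' y) (at y)" "\<And>y. (v' has_real_derivative p y * v y) (at y)"
    and p: "continuous_on UNIV p"
    and v_small: "(v \<longlongrightarrow> 0) at_top" and v_ne: "eventually (\<lambda>y. v y \<noteq> 0) at_top"
    and lim: "((\<lambda>y. u y / v y) \<longlongrightarrow> l) at_top"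
  shows "u y = l * v y"
proof -
  obtain t where "v t \<noteq> 0"
    using eventually_happens[OF v_ne] by auto
  have proportional: "u y = u t / v t * v y" for y
    by (rule linear_ode_proportional_if_wronskian_eq_0[OF u v p
          linear_ode_wronskian_eq_0_if_quotient_tendsto[OF u v v_small v_ne lim] \<open>v t \<noteq> 0\<close>])
  have "eventually (\<lambda>y. u y / v y = u t / v t) at_top"
    using v_ne by eventually_elim (subst proportional, simp)
  then have "l = u t / v t"
    using tendsto_unique[OF _ lim tendsto_eventually] by simp
  with proportional[of y] show ?thesis
    by (simp only:)
qed

subsection \<open>Gaussian means\<close>

lemma has_bochner_integral_gaussian:
  fixes k :: real
  assumes "k > 0"
  shows "has_bochner_integral lborel (\<lambda>x. exp (- k * x\<^sup>2)) (sqrt (pi / k))"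
proof -
  define s where "s = 1 / sqrt (2 * k)"
  have s: "s > 0" "s\<^sup>2 = 1 / (2 * k)"
    using assms by (auto simp: s_def power_divide)
  have density: "exp (- k * x\<^sup>2) = sqrt (pi / k) * normal_density 0 s x" for x
    using assms s by (simp add: normal_density_def real_sqrt_divide)
  have "has_bochner_integral lborel (normal_density 0 s) 1"
    using s(1) by (simp add: has_bochner_integral_iff)
  from has_bochner_integral_mult_right[OF this, of "sqrt (pi / k)"]
  show ?thesis unfolding density by simp
qed

lemmas integrable_gaussian = has_bochner_integral_gaussian[THEN integrable.intros]
lemmas integral_gaussian = has_bochner_integral_gaussian[THEN has_bochner_integral_integral_eq]

definition gaussian_mean :: "real \<Rightarrow> (real \<Rightarrow> real) \<Rightarrow> real" where
  "gaussian_mean k h = sqrt (k / pi) * (\<integral>u. exp (- k * u\<^sup>2) * h u \<partial>lborel)"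

lemma gaussian_mean_const:
  assumes "k > 0"
  shows "gaussian_mean k (\<lambda>u. c) = c"
proof -
  have "gaussian_mean k (\<lambda>u. c) = sqrt (k / pi) * sqrt (pi / k) * c"
    unfolding gaussian_mean_def integral_mult_left_zero integral_gaussian[OF assms] by simp
  also have "sqrt (k / pi) * sqrt (pi / k) = 1"
    using assms by (simp flip: real_sqrt_mult)
  finally show ?thesis by simp
qed

lemma abs_gaussian_mean_le:
  assumes "k > 0" and bound: "\<And>u. \<bar>h u\<bar> \<le> C"
  shows "\<bar>gaussian_mean k h\<bar> \<le> C"
proof (cases "integrable lborel (\<lambda>u. exp (- k * u\<^sup>2) * h u)")
  case True
  have "norm (\<integral>u. exp (- k * u\<^sup>2) * h u \<partial>lborel) \<le> (\<integral>u. exp (- k * u\<^sup>2) * C \<partial>lborel)"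
  proof (rule Bochner_Integration.integral_norm_bound_integral[OF True])
    show "integrable lborel (\<lambda>u. exp (- k * u\<^sup>2) * C)"
      by (intro integrable_mult_left integrable_gaussian assms(1))
  qed (auto simp: abs_mult intro!: mult_left_mono bound)
  then have "\<bar>gaussian_mean k h\<bar> \<le> gaussian_mean k (\<lambda>u. C)"
    using assms(1) unfolding gaussian_mean_def abs_mult by (intro mult_mono) auto
  then show ?thesis
    by (simp only: gaussian_mean_const[OF assms(1)])
next
  case False
  moreover have "0 \<le> C"
    using bound[of 0] by linarith
  ultimately show ?thesis
    unfolding gaussian_mean_def by (subst not_integrable_integral_eq) simp_all
qed

lemma gaussian_mean_rescale:
  assumes "s > 0"
  shows "gaussian_mean (k * s\<^sup>2) h = gaussian_mean k (\<lambda>u. h (u / s))"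
proof -
  have "(\<integral>u. exp (- (k * s\<^sup>2) * u\<^sup>2) * h u \<partial>lborel) =
      \<bar>1 / s\<bar> *\<^sub>R (\<integral>u. exp (- (k * s\<^sup>2) * (0 + 1 / s * u)\<^sup>2) * h (0 + 1 / s * u) \<partial>lborel)"
    using assms by (intro lborel_integral_real_affine) simp
  also have "\<dots> = (\<integral>u. exp (- k * u\<^sup>2) * h (u / s) \<partial>lborel) / s"
    using assms by (simp add: power_divide)
  finally have "gaussian_mean (k * s\<^sup>2) h =
      sqrt (k * s\<^sup>2 / pi) / s * (\<integral>u. exp (- k * u\<^sup>2) * h (u / s) \<partial>lborel)"
    unfolding gaussian_mean_def by simp
  also have "sqrt (k * s\<^sup>2 / pi) / s = sqrt (k / pi)"
    using assms by (simp add: real_sqrt_divide real_sqrt_mult)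
  finally show ?thesis
    by (simp only: gaussian_mean_def)
qed

lemma tendsto_gaussian_mean:
  fixes h :: "real \<Rightarrow> real \<Rightarrow> real"
  assumes "k > 0"
    and meas: "g \<in> borel_measurable borel" "\<And>y. h y \<in> borel_measurable borel"
    and bound: "eventually (\<lambda>y. \<forall>u. \<bar>h y u\<bar> \<le> C) at_top"
    and lim: "\<And>u. ((\<lambda>y. h y u) \<longlongrightarrow> g u) at_top"
  shows "((\<lambda>y. gaussian_mean k (h y)) \<longlongrightarrow> gaussian_mean k g) at_top"
  unfolding gaussian_mean_def
proof (intro tendsto_mult_left integral_dominated_convergence_at_top)
  show "integrable lborel (\<lambda>u. exp (- k * u\<^sup>2) * C)"
    by (intro integrable_mult_left integrable_gaussian assms(1))
  show "AE u in lborel. ((\<lambda>y. exp (- k * u\<^sup>2) * h y u) \<longlongrightarrow> exp (- k * u\<^sup>2) * g u) at_top"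
    by (intro AE_I2 tendsto_mult_left lim)
  show "eventually (\<lambda>y. AE u in lborel. norm (exp (- k * u\<^sup>2) * h y u) \<le> exp (- k * u\<^sup>2) * C) at_top"
    using bound by eventually_elim (auto simp: abs_mult intro!: mult_left_mono)
qed (use meas in simp_all)

lemma borel_measurable_gaussian_mean [measurable (raw)]:
  assumes [measurable]: "case_prod h \<in> borel_measurable (M \<Otimes>\<^sub>M borel)"
  shows "(\<lambda>t. gaussian_mean k (h t)) \<in> borel_measurable M"
  unfolding gaussian_mean_def by measurable

subsection \<open>Families of functions with Gaussian decay\<close>

text \<open>The factor \<open>exp (m * \<bar>z\<bar>)\<close> makes the class stable under multiplication by the case \<open>k = 0\<close>.\<close>

definition gauss_bounded :: "real \<Rightarrow> 'a set \<Rightarrow> ('a \<Rightarrow> real \<Rightarrow> 'b::real_normed_vector) \<Rightarrow> bool" where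
  "gauss_bounded k A f \<longleftrightarrow> (\<exists>C m. \<forall>y\<in>A. \<forall>z. norm (f y z) \<le> C * exp (m * \<bar>z\<bar> - k * z\<^sup>2))"

abbreviation exp_bounded :: "'a set \<Rightarrow> ('a \<Rightarrow> real \<Rightarrow> 'b::real_normed_vector) \<Rightarrow> bool" where
  "exp_bounded \<equiv> gauss_bounded 0"

lemma gauss_boundedI:
  assumes "\<And>y z. y \<in> A \<Longrightarrow> norm (f y z) \<le> C * exp (m * \<bar>z\<bar> - k * z\<^sup>2)"
  shows "gauss_bounded k A f"
  using assms unfolding gauss_bounded_def by blast

lemma gauss_boundedE:
  assumes "gauss_bounded k A f"
  obtains C m where "0 \<le> C" "0 \<le> m" "\<And>y z. y \<in> A \<Longrightarrow> norm (f y z) \<le> C * exp (m * \<bar>z\<bar> - k * z\<^sup>2)"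
proof -
  obtain C m where bound: "\<And>y z. y \<in> A \<Longrightarrow> norm (f y z) \<le> C * exp (m * \<bar>z\<bar> - k * z\<^sup>2)"
    using assms unfolding gauss_bounded_def by blast
  have "norm (f y z) \<le> \<bar>C\<bar> * exp (\<bar>m\<bar> * \<bar>z\<bar> - k * z\<^sup>2)" if "y \<in> A" for y z
    using bound[OF that, of z] by (rule order_trans) (auto intro!: mult_mono mult_right_mono)
  then show ?thesis by (intro that[of "\<bar>C\<bar>" "\<bar>m\<bar>"]) auto
qed

named_theorems gauss_bounded_intros

lemma exp_bounded_bounded:
  assumes "bounded S" "\<And>y z. y \<in> A \<Longrightarrow> f y z \<in> S"
  shows "exp_bounded A f"
proof -
  obtain C where "\<And>w. w \<in> S \<Longrightarrow> norm w \<le> C"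
    using assms(1) unfolding bounded_iff by blast
  then show ?thesis
    using assms(2) by (intro gauss_boundedI[of A f C 0]) simp
qed

lemma exp_bounded_const [gauss_bounded_intros]: "exp_bounded A (\<lambda>y z. c)"
  by (rule exp_bounded_bounded[of "{c}"]) auto

lemma exp_bounded_fst [gauss_bounded_intros]:
  fixes A :: "'a::real_normed_vector set"
  shows "bounded A \<Longrightarrow> exp_bounded A (\<lambda>y z. y)"
  by (rule exp_bounded_bounded)

lemma exp_bounded_snd [gauss_bounded_intros]: "exp_bounded A (\<lambda>y z. z)"
proof (rule gauss_boundedI)
  show "norm z \<le> 1 * exp (1 * \<bar>z\<bar> - 0 * z\<^sup>2)" for z :: real
    using exp_ge_add_one_self[of "\<bar>z\<bar>"] unfolding real_norm_def by argo
qed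

lemma gauss_bounded_add [gauss_bounded_intros]:
  assumes "gauss_bounded k A f" "gauss_bounded k A g"
  shows "gauss_bounded k A (\<lambda>y z. f y z + g y z)"
proof -
  obtain C m where f: "0 \<le> C" "0 \<le> m" "\<And>y z. y \<in> A \<Longrightarrow> norm (f y z) \<le> C * exp (m * \<bar>z\<bar> - k * z\<^sup>2)"
    using assms(1) by (rule gauss_boundedE) blast
  obtain D n where g: "0 \<le> D" "0 \<le> n" "\<And>y z. y \<in> A \<Longrightarrow> norm (g y z) \<le> D * exp (n * \<bar>z\<bar> - k * z\<^sup>2)"
    using assms(2) by (rule gauss_boundedE) blast
  show ?thesis
  proof (rule gauss_boundedI)
    fix y z assume y: "y \<in> A"
    have "norm (f y z + g y z) \<le> C * exp (m * \<bar>z\<bar> - k * z\<^sup>2) + D * exp (n * \<bar>z\<bar> - k * z\<^sup>2)"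
      using f(3)[OF y, of z] g(3)[OF y, of z] by (rule norm_triangle_mono)
    also have "\<dots> \<le> C * exp ((m + n) * \<bar>z\<bar> - k * z\<^sup>2) + D * exp ((m + n) * \<bar>z\<bar> - k * z\<^sup>2)"
      using f g by (intro add_mono mult_left_mono) (auto intro!: mult_right_mono)
    finally show "norm (f y z + g y z) \<le> (C + D) * exp ((m + n) * \<bar>z\<bar> - k * z\<^sup>2)"
      by (simp only: distrib_right)
  qed
qed

lemma gauss_bounded_mult [gauss_bounded_intros]:
  fixes f g :: "'a \<Rightarrow> real \<Rightarrow> 'b::real_normed_algebra"
  assumes "exp_bounded A f" "gauss_bounded k A g"
  shows "gauss_bounded k A (\<lambda>y z. f y z * g y z)"
proof -
  obtain C m where f: "0 \<le> C" "0 \<le> m" "\<And>y z. y \<in> A \<Longrightarrow> norm (f y z) \<le> C * exp (m * \<bar>z\<bar> - 0 * z\<^sup>2)"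
    using assms(1) by (rule gauss_boundedE) blast
  obtain D n where g: "0 \<le> D" "0 \<le> n" "\<And>y z. y \<in> A \<Longrightarrow> norm (g y z) \<le> D * exp (n * \<bar>z\<bar> - k * z\<^sup>2)"
    using assms(2) by (rule gauss_boundedE) blast
  show ?thesis
  proof (rule gauss_boundedI)
    fix y z assume y: "y \<in> A"
    have "norm (f y z * g y z) \<le> norm (f y z) * norm (g y z)"
      by (rule norm_mult_ineq)
    also have "\<dots> \<le> (C * exp (m * \<bar>z\<bar> - 0 * z\<^sup>2)) * (D * exp (n * \<bar>z\<bar> - k * z\<^sup>2))"
      using f g y by (intro mult_mono) auto
    also have "\<dots> = C * D * exp ((m + n) * \<bar>z\<bar> - k * z\<^sup>2)"
      by (simp add: algebra_simps exp_add exp_diff)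
    finally show "norm (f y z * g y z) \<le> C * D * exp ((m + n) * \<bar>z\<bar> - k * z\<^sup>2)" .
  qed
qed

lemma exp_bounded_power [gauss_bounded_intros]:
  fixes f :: "'a \<Rightarrow> real \<Rightarrow> 'b::real_normed_algebra_1"
  shows "exp_bounded A f \<Longrightarrow> exp_bounded A (\<lambda>y z. f y z ^ n)"
  by (induction n) (auto intro: gauss_bounded_intros)

lemma gauss_bounded_diff [gauss_bounded_intros]:
  assumes "gauss_bounded k A f" "gauss_bounded k A g"
  shows "gauss_bounded k A (\<lambda>y z. f y z - g y z)"
proof -
  have "gauss_bounded k A (\<lambda>y z. - g y z)"
    using assms(2) by (simp add: gauss_bounded_def)
  from gauss_bounded_add[OF assms(1) this] show ?thesis by simp
qed

lemma exp_bounded_exp_product [gauss_bounded_intros]: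
  assumes "bounded A"
  shows "exp_bounded A (\<lambda>y z. exp (c * y * z))"
proof -
  obtain Y where Y: "\<And>y. y \<in> A \<Longrightarrow> \<bar>y\<bar> \<le> Y"
    using assms unfolding bounded_iff by auto
  show ?thesis
  proof (rule gauss_boundedI)
    fix y z :: real assume "y \<in> A"
    have "c * y * z \<le> \<bar>c\<bar> * \<bar>y\<bar> * \<bar>z\<bar>"
      by (simp flip: abs_mult)
    also have "\<dots> \<le> \<bar>c\<bar> * Y * \<bar>z\<bar>"
      using Y[OF \<open>y \<in> A\<close>] by (intro mult_right_mono mult_left_mono) auto
    finally show "norm (exp (c * y * z)) \<le> 1 * exp (\<bar>c\<bar> * Y * \<bar>z\<bar> - 0 * z\<^sup>2)" by simp
  qed
qed

lemma exp_bounded_antiderivative: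
  fixes f :: "real \<Rightarrow> real"
  assumes deriv: "\<And>z. (f has_real_derivative f' z) (at z)" and f': "exp_bounded UNIV (\<lambda>(_::unit). f')"
  shows "exp_bounded A (\<lambda>y. f)"
proof -
  obtain C m where C: "0 \<le> C" "0 \<le> m" "\<And>z. \<bar>f' z\<bar> \<le> C * exp (m * \<bar>z\<bar>)"
    using f' by (rule gauss_boundedE) auto
  have "norm (f z - f 0) \<le> C * exp (m * \<bar>z\<bar>) * norm (z - 0)" for z
  proof (rule field_differentiable_bound[of "closed_segment 0 z"])
    show "(f has_real_derivative f' s) (at s within closed_segment 0 z)" for s
      using deriv by (rule has_field_derivative_at_within)
    show "norm (f' s) \<le> C * exp (m * \<bar>z\<bar>)" if "s \<in> closed_segment 0 z" for s
    proof -
      have "\<bar>s\<bar> \<le> \<bar>z\<bar>" using that by (auto simp: closed_segment_eq_real_ivl split: if_splits)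
      then have "C * exp (m * \<bar>s\<bar>) \<le> C * exp (m * \<bar>z\<bar>)"
        using C by (intro mult_left_mono) (auto intro: mult_left_mono)
      then show ?thesis using C(3)[of s] by simp
    qed
  qed auto
  then have mean_value: "\<bar>f z - f 0\<bar> \<le> C * exp (m * \<bar>z\<bar>) * \<bar>z\<bar>" for z
    by simp
  have "exp_bounded A (\<lambda>y z. f z - f 0)"
  proof (rule gauss_boundedI)
    fix z
    have "\<bar>f z - f 0\<bar> \<le> C * exp (m * \<bar>z\<bar>) * exp \<bar>z\<bar>"
      using exp_ge_add_one_self[of "\<bar>z\<bar>"] C(1)
      by (intro order_trans[OF mean_value] mult_left_mono) (argo, simp)
    then show "norm (f z - f 0) \<le> C * exp ((m + 1) * \<bar>z\<bar> - 0 * z\<^sup>2)"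
      by (simp add: algebra_simps exp_add)
  qed
  then have "exp_bounded A (\<lambda>y z. (f z - f 0) + f 0)"
    by (rule gauss_bounded_add[OF _ exp_bounded_const])
  then show ?thesis by simp
qed

lemma gauss_bounded_dominated:
  assumes "k > 0" "gauss_bounded k A f"
  obtains C where "0 \<le> C" "\<And>y z. y \<in> A \<Longrightarrow> norm (f y z) \<le> C * exp (- (k / 2) * z\<^sup>2)"
proof -
  obtain C m where f: "0 \<le> C" "0 \<le> m" "\<And>y z. y \<in> A \<Longrightarrow> norm (f y z) \<le> C * exp (m * \<bar>z\<bar> - k * z\<^sup>2)"
    using assms(2) by (rule gauss_boundedE) blast
  have square: "m * \<bar>z\<bar> - k * z\<^sup>2 \<le> m\<^sup>2 / (2 * k) + - (k / 2) * z\<^sup>2" for z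
  proof -
    have "0 \<le> (k * \<bar>z\<bar> - m)\<^sup>2 / (2 * k)" using assms(1) by simp
    also have "\<dots> = k / 2 * z\<^sup>2 - m * \<bar>z\<bar> + m\<^sup>2 / (2 * k)"
      using assms(1) by (simp add: power2_diff field_simps power2_eq_square[of k])
    finally show ?thesis by simp
  qed
  have "norm (f y z) \<le> C * exp (m\<^sup>2 / (2 * k)) * exp (- (k / 2) * z\<^sup>2)" if "y \<in> A" for y z
    using f(3)[OF that, of z] unfolding mult.assoc exp_add[symmetric]
    by (rule order_trans) (intro mult_left_mono f(1), use square in simp)
  then show ?thesis
    using f(1) by (intro that[of "C * exp (m\<^sup>2 / (2 * k))"]) auto
qed

lemma gauss_bounded_integrable:
  fixes f :: "'a \<Rightarrow> real \<Rightarrow> 'b::{banach,second_countable_topology}"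
  assumes k: "k > 0" and f: "gauss_bounded k A f" and y: "y \<in> A" and cont: "continuous_on UNIV (f y)"
  shows "integrable lborel (f y)"
proof -
  obtain C where C: "0 \<le> C" "\<And>z. norm (f y z) \<le> C * exp (- (k / 2) * z\<^sup>2)"
    using gauss_bounded_dominated[OF k f] y by metis
  show ?thesis
  proof (rule Bochner_Integration.integrable_bound)
    show "integrable lborel (\<lambda>z. C * exp (- (k / 2) * z\<^sup>2))"
      using k by (intro integrable_mult_right integrable_gaussian) simp
    show "f y \<in> borel_measurable lborel"
      using cont by (simp add: borel_measurable_continuous_onI)
    show "AE z in lborel. norm (f y z) \<le> norm (C * exp (- (k / 2) * z\<^sup>2))"
      using C by (intro AE_I2) simp
  qed
qed

lemma gauss_bounded_tendsto_0:
  assumes k: "k > 0" and f: "gauss_bounded k A f" and y: "y \<in> A" and F: "F = at_top \<or> F = at_bot"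
  shows "(f y \<longlongrightarrow> 0) F"
proof -
  obtain C where C: "\<And>z. norm (f y z) \<le> C * exp (- (k / 2) * z\<^sup>2)"
    using gauss_bounded_dominated[OF k f] y by metis
  have "((\<lambda>z. exp (- (k / 2) * z\<^sup>2)) \<longlongrightarrow> 0) F"
    using F k by (elim disjE; simp only:; real_asymp)
  then have "((\<lambda>z. C * exp (- (k / 2) * z\<^sup>2)) \<longlongrightarrow> 0) F"
    by (rule tendsto_mult_right_zero)
  with always_eventually show ?thesis
    by (rule Lim_null_comparison) (use C in blast)
qed

proposition has_vector_derivative_integral_gauss_bounded:
  fixes f :: "real \<Rightarrow> real \<Rightarrow> 'b::{banach,second_countable_topology}"
  assumes k: "k > 0"
    and f: "\<And>A. bounded A \<Longrightarrow> gauss_bounded k A f" "\<And>y. continuous_on UNIV (f y)"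
    and f': "\<And>A. bounded A \<Longrightarrow> gauss_bounded k A f'" "\<And>y. continuous_on UNIV (f' y)"
    and deriv: "\<And>y z. ((\<lambda>y. f y z) has_vector_derivative f' y z) (at y)"
  shows "((\<lambda>y. \<integral>z. f y z \<partial>lborel) has_vector_derivative (\<integral>z. f' y z \<partial>lborel)) (at y)"
proof -
  obtain C where C: "\<And>t z. t \<in> ball y 1 \<Longrightarrow> norm (f' t z) \<le> C * exp (- (k / 2) * z\<^sup>2)"
    using gauss_bounded_dominated[OF k f'(1)[OF bounded_ball]] by metis
  have "((\<lambda>y. \<integral>z. f y z \<partial>lborel) has_vector_derivative (\<integral>z. f' y z \<partial>lborel)) (at y within ball y 1)"
  proof (rule has_vector_derivative_lebesgue_integral[OF _ _ _ _ _ C])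
    show "((\<lambda>y. f y z) has_vector_derivative f' t z) (at t within ball y 1)" for t z
      using deriv by (rule has_vector_derivative_at_within)
    show "integrable lborel (f t)" for t
      using gauss_bounded_integrable[OF k f(1) _ f(2), of "{t}"] by simp
    show "f' y \<in> borel_measurable lborel"
      using f'(2) by (simp add: borel_measurable_continuous_onI)
    show "integrable lborel (\<lambda>z. C * exp (- (k / 2) * z\<^sup>2))"
      using k by (intro integrable_mult_right integrable_gaussian) simp
  qed auto
  then show ?thesis
    by (simp add: at_within_open[of y "ball y 1"])
qed

corollary has_real_derivative_integral_mult_gauss_bounded:
  fixes f :: "real \<Rightarrow> real" and k k' :: "real \<Rightarrow> real \<Rightarrow> real"
  assumes "r > 0"
    and f: "\<And>A. exp_bounded A (\<lambda>y::real. f)" "continuous_on UNIV f"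
    and k: "\<And>A. bounded A \<Longrightarrow> gauss_bounded r A k" "\<And>y. continuous_on UNIV (k y)"
    and k': "\<And>A. bounded A \<Longrightarrow> gauss_bounded r A k'" "\<And>y. continuous_on UNIV (k' y)"
    and deriv: "\<And>y z. ((\<lambda>y. k y z) has_real_derivative k' y z) (at y)"
  shows "((\<lambda>y. \<integral>z. f z * k y z \<partial>lborel) has_real_derivative (\<integral>z. f z * k' y z \<partial>lborel)) (at y)"
  unfolding has_real_derivative_iff_has_vector_derivative
proof (rule has_vector_derivative_integral_gauss_bounded[OF assms(1)])
  show "((\<lambda>y. f z * k y z) has_vector_derivative f z * k' y z) (at y)" for y z
    using DERIV_cmult[OF deriv] by (simp add: has_real_derivative_iff_has_vector_derivative)
qed (intro gauss_bounded_mult continuous_on_mult f k k'; assumption)+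

subsection \<open>The Airy function on vertical lines\<close>

lemma airy_integrand_has_field_derivative:
  "(airy_integrand x has_field_derivative (z\<^sup>2 - of_real x) * airy_integrand x z) (at z)"
  unfolding airy_integrand_def[abs_def]
  by (auto intro!: derivative_eq_intros simp: field_simps)

lemma continuous_on_airy_integrand [continuous_intros]:
  "continuous_on S f \<Longrightarrow> continuous_on S (\<lambda>s. airy_integrand x (f s))"
  unfolding airy_integrand_def by (intro continuous_intros) auto

lemma norm_airy_integrand:
  "norm (airy_integrand x (Complex u v)) = exp (u ^ 3 / 3 - u * v\<^sup>2 - u * x)"
  by (simp add: airy_integrand_def power3_eq_cube power2_eq_square field_simps)

lemma norm_airy_integrand_sector_le:
  assumes "0 \<le> u" "u \<le> \<bar>v\<bar>"
  shows "norm (airy_integrand x (Complex u v)) \<le> exp (u * (\<bar>x\<bar> - 2/3 * v\<^sup>2))"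
proof -
  have "u\<^sup>2 \<le> v\<^sup>2"
    using power_mono[OF assms(2,1), of 2] by simp
  then have "u\<^sup>2 / 3 - v\<^sup>2 - x \<le> \<bar>x\<bar> - 2/3 * v\<^sup>2"
    by linarith
  then have "u * (u\<^sup>2 / 3 - v\<^sup>2 - x) \<le> u * (\<bar>x\<bar> - 2/3 * v\<^sup>2)"
    using assms(1) by (rule mult_left_mono)
  moreover have "u ^ 3 / 3 - u * v\<^sup>2 - u * x = u * (u\<^sup>2 / 3 - v\<^sup>2 - x)"
    by (simp add: algebra_simps power3_eq_cube power2_eq_square)
  ultimately show ?thesis
    by (simp add: norm_airy_integrand)
qed

lemma linear_minus_cubic_le:
  fixes \<alpha> \<beta> r :: real
  assumes "\<beta> > 0" "r \<ge> 0"
  shows "\<alpha> * r - \<beta> * r ^ 3 \<le> \<alpha>\<^sup>2 / 4 + 32 / (27 * \<beta>\<^sup>2) - r\<^sup>2"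
proof -
  define s where "s = 2 / (3 * \<beta>)"
  have "0 \<le> (r - 2 * s)\<^sup>2 * (r + s)"
    using assms by (simp add: s_def)
  also have "\<dots> = r ^ 3 - 3 * s * r\<^sup>2 + 4 * s ^ 3"
    by (simp add: power2_eq_square power3_eq_cube algebra_simps)
  finally have "0 \<le> \<beta> * (r ^ 3 - 3 * s * r\<^sup>2 + 4 * s ^ 3)"
    using assms(1) by (intro mult_nonneg_nonneg) auto
  also have "\<dots> = \<beta> * r ^ 3 - 2 * r\<^sup>2 + 32 / (27 * \<beta>\<^sup>2)"
    using assms(1) by (simp add: s_def field_simps power3_eq_cube power2_eq_square)
  finally have "2 * r\<^sup>2 - 32 / (27 * \<beta>\<^sup>2) \<le> \<beta> * r ^ 3"
    by linarith
  moreover have "0 \<le> (\<alpha> / 2 - r)\<^sup>2"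
    by simp
  then have "\<alpha> * r \<le> \<alpha>\<^sup>2 / 4 + r\<^sup>2"
    by (simp add: power2_diff power_divide)
  ultimately show ?thesis by linarith
qed

text \<open>The two rays defining the Airy function lie in the sectors \<open>0 < Re w \<le> \<bar>Im w\<bar>\<close>.\<close>

lemma set_integrable_airy_ray:
  assumes "0 < Re w" "Re w \<le> \<bar>Im w\<bar>"
  shows "set_integrable lborel {0..} (\<lambda>r. airy_integrand x (of_real r * w) * w)"
  unfolding set_integrable_def
proof (rule Bochner_Integration.integrable_bound)
  define \<alpha> \<beta> where "\<alpha> = Re w * \<bar>x\<bar>" and "\<beta> = 2/3 * Re w * (Im w)\<^sup>2"
  define C where "C = exp (\<alpha>\<^sup>2 / 4 + 32 / (27 * \<beta>\<^sup>2)) * norm w"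
  show "integrable lborel (\<lambda>r. C * exp (- 1 * r\<^sup>2))"
    by (intro integrable_mult_right integrable_gaussian) simp
  have "(\<lambda>r. airy_integrand x (of_real r * w) * w) \<in> borel_measurable borel"
    by (intro borel_measurable_continuous_onI continuous_intros)
  then show "(\<lambda>r. indicator {0..} r *\<^sub>R (airy_integrand x (of_real r * w) * w)) \<in> borel_measurable lborel"
    by simp
  have "norm (airy_integrand x (of_real r * w) * w) \<le> C * exp (- 1 * r\<^sup>2)" if "r \<ge> 0" for r
  proof -
    have "of_real r * w = Complex (r * Re w) (r * Im w)"
      by (simp add: complex_eq_iff)
    then have "norm (airy_integrand x (of_real r * w)) \<le> exp (r * Re w * (\<bar>x\<bar> - 2/3 * (r * Im w)\<^sup>2))"
      using assms that
      by (simp only:, intro norm_airy_integrand_sector_le) (auto simp: abs_mult intro: mult_left_mono)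
    also have "r * Re w * (\<bar>x\<bar> - 2/3 * (r * Im w)\<^sup>2) = \<alpha> * r - \<beta> * r ^ 3"
      by (simp add: \<alpha>_def \<beta>_def algebra_simps power2_eq_square power3_eq_cube)
    also have "exp \<dots> \<le> exp (\<alpha>\<^sup>2 / 4 + 32 / (27 * \<beta>\<^sup>2)) * exp (- 1 * r\<^sup>2)"
      using linear_minus_cubic_le[of \<beta> r \<alpha>] assms that by (simp add: \<beta>_def flip: exp_add)
    finally have "norm (airy_integrand x (of_real r * w) * w) \<le>
        exp (\<alpha>\<^sup>2 / 4 + 32 / (27 * \<beta>\<^sup>2)) * exp (- 1 * r\<^sup>2) * norm w"
      unfolding norm_mult by (rule mult_right_mono) simp
    then show ?thesis by (simp only: C_def mult_ac)
  qed
  then show "AE r in lborel. norm (indicator {0..} r *\<^sub>R (airy_integrand x (of_real r * w) * w))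
      \<le> norm (C * exp (- 1 * r\<^sup>2))"
    by (intro AE_I2) (auto simp: C_def split: split_indicator)
qed

lemma tendsto_primitive_along_ray:
  fixes f G :: "complex \<Rightarrow> complex"
  assumes G: "\<And>z. (G has_field_derivative f z) (at z)" and f: "continuous_on UNIV f"
    and int: "set_integrable lborel {0..} (\<lambda>r. f (of_real r * w) * w)"
  shows "((\<lambda>r. G (of_real r * w)) \<longlongrightarrow> G 0 + (LINT r:{0..}|lborel. f (of_real r * w) * w)) at_top"
proof -
  have "((\<lambda>r. G (of_real r * w)) has_vector_derivative f (of_real r * w) * w) (at r)" for r
  proof -
    have "((\<lambda>r. of_real r * w) has_vector_derivative w) (at r)"
      by (auto intro!: derivative_eq_intros)
    from field_vector_diff_chain_at[OF this G] show ?thesis by (simp add: o_def mult.commute)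
  qed
  then have "(LINT r:{0..b}|lborel. f (of_real r * w) * w) = G (of_real b * w) - G (of_real 0 * w)"
    if "b \<ge> 0" for b
    unfolding set_lebesgue_integral_def using that
    by (intro integral_FTC_Icc continuous_intros continuous_on_compose2[OF f])
      (auto intro: has_vector_derivative_at_within)
  then have "eventually (\<lambda>b. G 0 + (LINT r:{0..b}|lborel. f (of_real r * w) * w) = G (of_real b * w)) at_top"
    by (intro eventually_at_top_linorderI[of 0]) simp
  moreover have "((\<lambda>b. G 0 + (LINT r:{0..b}|lborel. f (of_real r * w) * w)) \<longlongrightarrow>
      G 0 + (LINT r:{0..}|lborel. f (of_real r * w) * w)) at_top"
    by (intro tendsto_add tendsto_const tendsto_set_lebesgue_integral_at_top int) simp
  ultimately show ?thesis
    by (rule Lim_transform_eventually[rotated])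
qed

lemma airy_primitive_horizontal_difference_le:
  assumes G: "\<And>z. (G has_field_derivative airy_integrand x z) (at z)"
    and "0 < c" "c \<le> u" "u \<le> \<bar>v\<bar>" and x: "\<bar>x\<bar> \<le> 2/3 * v\<^sup>2"
  shows "norm (G (Complex u v) - G (Complex c v)) \<le> exp (c * (\<bar>x\<bar> - 2/3 * v\<^sup>2)) * (u - c)"
proof -
  let ?L = "closed_segment (Complex c v) (Complex u v)"
  have "norm (G (Complex u v) - G (Complex c v)) \<le>
      exp (c * (\<bar>x\<bar> - 2/3 * v\<^sup>2)) * norm (Complex u v - Complex c v)"
  proof (rule field_differentiable_bound[of ?L])
    show "(G has_field_derivative airy_integrand x z) (at z within ?L)" for z
      using G by (rule has_field_derivative_at_within)
    show "norm (airy_integrand x z) \<le> exp (c * (\<bar>x\<bar> - 2/3 * v\<^sup>2))" if "z \<in> ?L" for z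
    proof -
      have z: "z = Complex (Re z) v" "c \<le> Re z" "Re z \<le> u"
        using that assms(3) by (auto simp: closed_segment_same_Im closed_segment_eq_real_ivl complex_eq_iff)
      then have "norm (airy_integrand x z) \<le> exp (Re z * (\<bar>x\<bar> - 2/3 * v\<^sup>2))"
        using norm_airy_integrand_sector_le[of "Re z" v x] assms(2-4) by simp
      also have "\<dots> \<le> exp (c * (\<bar>x\<bar> - 2/3 * v\<^sup>2))"
        using z(2) x by (simp add: mult_right_mono_neg)
      finally show ?thesis .
    qed
  qed auto
  also have "norm (Complex u v - Complex c v) = u - c"
    using assms(3) by (simp add: cmod_def)
  finally show ?thesis .
qed

definition airy_ray :: "real \<Rightarrow> complex \<Rightarrow> complex" where
  "airy_ray x w = (LINT r:{0..}|lborel. airy_integrand x (of_real r * w) * w)"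

lemma tendsto_airy_primitive_ray_minus_vertical:
  assumes G: "\<And>z. (G has_field_derivative airy_integrand x z) (at z)"
    and c: "c > 0" and w: "0 < Re w" "Re w \<le> \<bar>Im w\<bar>"
  shows "((\<lambda>r. G (of_real r * w) - G (Complex c (r * Im w))) \<longlongrightarrow> 0) at_top"
proof (rule Lim_null_comparison)
  define q where "q = 2/3 * (Im w)\<^sup>2"
  have "q > 0"
    using w by (auto simp: q_def)
  then show "((\<lambda>r. exp (c * (\<bar>x\<bar> - q * r\<^sup>2)) * (r * Re w - c)) \<longlongrightarrow> 0) at_top"
    using w(1) c by real_asymp
  have "eventually (\<lambda>r. \<bar>x\<bar> \<le> q * r\<^sup>2) at_top"
    using \<open>q > 0\<close> by real_asymp
  then show "eventually (\<lambda>r. norm (G (of_real r * w) - G (Complex c (r * Im w))) \<le>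
      exp (c * (\<bar>x\<bar> - q * r\<^sup>2)) * (r * Re w - c)) at_top"
    using eventually_ge_at_top[of "c / Re w"] eventually_gt_at_top[of 0]
  proof eventually_elim
    case (elim r)
    have height: "2/3 * (r * Im w)\<^sup>2 = q * r\<^sup>2"
      by (simp add: q_def power_mult_distrib)
    have "of_real r * w = Complex (r * Re w) (r * Im w)"
      by (simp add: complex_eq_iff)
    moreover have "c \<le> r * Re w"
      using elim(2) w(1) by (simp add: divide_le_eq)
    moreover have "r * Re w \<le> \<bar>r * Im w\<bar>"
      using elim(3) w(2) by (simp add: abs_mult)
    ultimately show ?case
      using airy_primitive_horizontal_difference_le[OF G c, of "r * Re w" "r * Im w"] elim(1)
      unfolding height by simp
  qed
qed

lemma tendsto_airy_primitive_vertical: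
  assumes G: "\<And>z. (G has_field_derivative airy_integrand x z) (at z)"
    and "c > 0" and w: "0 < Re w" "Re w \<le> \<bar>Im w\<bar>"
  shows "((\<lambda>r. G (Complex c (r * Im w))) \<longlongrightarrow> G 0 + airy_ray x w) at_top"
proof -
  have "((\<lambda>r. G (of_real r * w)) \<longlongrightarrow> G 0 + airy_ray x w) at_top"
    unfolding airy_ray_def
    by (intro tendsto_primitive_along_ray[OF G] set_integrable_airy_ray[OF w] continuous_intros)
  from tendsto_diff[OF this tendsto_airy_primitive_ray_minus_vertical[OF assms]]
  show ?thesis by simp
qed

lemma has_vector_derivative_Complex_Im:
  "((\<lambda>\<sigma>. Complex c \<sigma>) has_vector_derivative \<i>) (at \<sigma>)"
  unfolding Complex_eq by (auto intro!: derivative_eq_intros)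

lemma exp_bounded_Complex [gauss_bounded_intros]: "exp_bounded A (\<lambda>t \<sigma>. Complex c \<sigma>)"
proof (rule gauss_boundedI)
  fix \<sigma> :: real
  have "norm (Complex c \<sigma>) \<le> \<bar>c\<bar> * 1 + 1 * \<bar>\<sigma>\<bar>"
    using cmod_le[of "Complex c \<sigma>"] by simp
  also have "\<dots> \<le> \<bar>c\<bar> * exp \<bar>\<sigma>\<bar> + 1 * exp \<bar>\<sigma>\<bar>"
    using exp_ge_add_one_self[of "\<bar>\<sigma>\<bar>"] by (intro add_mono mult_left_mono) (simp, simp, argo, simp)
  finally show "norm (Complex c \<sigma>) \<le> (\<bar>c\<bar> + 1) * exp (1 * \<bar>\<sigma>\<bar> - 0 * \<sigma>\<^sup>2)"
    by (simp add: distrib_right)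
qed

lemma gauss_bounded_airy_line:
  assumes "bounded A"
  shows "gauss_bounded c A (\<lambda>t \<sigma>. Complex c \<sigma> ^ n * airy_integrand t (Complex c \<sigma>))"
proof (intro gauss_bounded_intros)
  obtain B where B: "\<And>t. t \<in> A \<Longrightarrow> \<bar>t\<bar> \<le> B"
    using assms unfolding bounded_iff by auto
  show "gauss_bounded c A (\<lambda>t \<sigma>. airy_integrand t (Complex c \<sigma>))"
  proof (rule gauss_boundedI)
    fix t \<sigma> assume "t \<in> A"
    have "- (c * t) \<le> \<bar>c\<bar> * \<bar>t\<bar>"
      by (metis abs_ge_minus_self abs_mult)
    also have "\<dots> \<le> \<bar>c\<bar> * B"
      using B[OF \<open>t \<in> A\<close>] by (rule mult_left_mono) simp
    finally show "norm (airy_integrand t (Complex c \<sigma>)) \<le> exp (c ^ 3 / 3 + \<bar>c\<bar> * B) * exp (0 * \<bar>\<sigma>\<bar> - c * \<sigma>\<^sup>2)"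
      by (simp add: norm_airy_integrand flip: exp_add)
  qed
qed

lemma continuous_on_airy_line: "continuous_on S (\<lambda>\<sigma>. Complex c \<sigma> ^ n * airy_integrand t (Complex c \<sigma>))"
  unfolding Complex_eq by (intro continuous_intros)

lemma integrable_airy_line:
  assumes "c > 0"
  shows "integrable lborel (\<lambda>\<sigma>. Complex c \<sigma> ^ n * airy_integrand t (Complex c \<sigma>))"
  by (rule gauss_bounded_integrable[OF assms gauss_bounded_airy_line[of "{t}"]])
    (auto intro: continuous_on_airy_line)

text \<open>Cauchy's theorem in the form of a global primitive: both rays and the vertical line
  are evaluated by the same limits of the primitive at infinity.\<close>

proposition integral_airy_line_eq_rays:
  assumes "c > 0"
    and w: "0 < Re w" "Re w \<le> Im w" and w': "0 < Re w'" "Re w' \<le> - Im w'"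
  shows "(\<integral>\<sigma>. airy_integrand x (Complex c \<sigma>) \<partial>lborel) = (airy_ray x w - airy_ray x w') / \<i>"
proof -
  have "airy_integrand x holomorphic_on UNIV"
    using airy_integrand_has_field_derivative by (intro holomorphic_onI) (auto simp: field_differentiable_def)
  then obtain G where G: "\<And>z. (G has_field_derivative airy_integrand x z) (at z)"
    using holomorphic_convex_primitive'[of UNIV "airy_integrand x"] by auto
  have "((\<lambda>\<sigma>. G (Complex c (\<sigma> / Im w * Im w))) \<longlongrightarrow> G 0 + airy_ray x w) at_top"
  proof (rule filterlim_compose[OF tendsto_airy_primitive_vertical[OF G assms(1)]])
    show "filterlim (\<lambda>\<sigma>. \<sigma> / Im w) at_top at_top"
      using w by real_asymp
  qed (use w in auto)
  then have top: "((\<lambda>\<sigma>. - \<i> * G (Complex c \<sigma>)) \<longlongrightarrow> - \<i> * (G 0 + airy_ray x w)) at_top"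
    using w by (intro tendsto_mult_left) simp
  have "((\<lambda>\<sigma>. G (Complex c (\<sigma> / Im w' * Im w'))) \<longlongrightarrow> G 0 + airy_ray x w') at_bot"
  proof (rule filterlim_compose[OF tendsto_airy_primitive_vertical[OF G assms(1)]])
    show "filterlim (\<lambda>\<sigma>. \<sigma> / Im w') at_top at_bot"
      using w' by real_asymp
  qed (use w' in auto)
  then have bot: "((\<lambda>\<sigma>. - \<i> * G (Complex c \<sigma>)) \<longlongrightarrow> - \<i> * (G 0 + airy_ray x w')) at_bot"
    using w' by (intro tendsto_mult_left) simp
  have "((\<lambda>\<sigma>. - \<i> * G (Complex c \<sigma>)) has_vector_derivative airy_integrand x (Complex c \<sigma>)) (at \<sigma>)" for \<sigma>
    using has_vector_derivative_mult_right[OF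
        field_vector_diff_chain_at[OF has_vector_derivative_Complex_Im G], of "- \<i>"]
    by (simp add: o_def)
  then have "(\<integral>\<sigma>. airy_integrand x (Complex c \<sigma>) \<partial>lborel) =
      - \<i> * (G 0 + airy_ray x w) - - \<i> * (G 0 + airy_ray x w')"
    using integral_FTC_real_line[OF _ _ _ bot top] continuous_on_airy_line[of UNIV c 0 x]
      integrable_airy_line[OF assms(1), of 0 x] by simp
  then show ?thesis by (simp add: algebra_simps)
qed

lemma Airy_Ai_eq_line_integral:
  assumes "c > 0"
  shows "Airy_Ai x = Re (\<integral>\<sigma>. airy_integrand x (Complex c \<sigma>) \<partial>lborel) / (2 * pi)"
proof -
  have "1 / 2 \<le> sqrt 3 / 2"
    by simp
  then have "(\<integral>\<sigma>. airy_integrand x (Complex c \<sigma>) \<partial>lborel) =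
      (airy_ray x (cis (pi/3)) - airy_ray x (cis (- (pi/3)))) / \<i>"
    using assms by (intro integral_airy_line_eq_rays) (simp_all add: cos_60 sin_60)
  moreover have "1 / (2 * of_real pi * \<i>) * z = z / \<i> / of_real (2 * pi)" for z :: complex
    by (simp add: field_simps)
  ultimately show ?thesis
    by (simp only: Airy_Ai_def airy_ray_def[symmetric] Re_divide_of_real)
qed

subsection \<open>Derivatives of the Airy function\<close>

definition airy_moment :: "nat \<Rightarrow> real \<Rightarrow> complex" where
  "airy_moment n t = (\<integral>\<sigma>. Complex 1 \<sigma> ^ n * airy_integrand t (Complex 1 \<sigma>) \<partial>lborel)"

lemma norm_airy_moment_le:
  "norm (airy_moment n t) \<le> (\<integral>\<sigma>. norm (Complex 1 \<sigma>) ^ n * exp (1/3 - \<sigma>\<^sup>2) \<partial>lborel) * exp (- t)"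
proof -
  have "norm (airy_moment n t) \<le> (\<integral>\<sigma>. norm (Complex 1 \<sigma> ^ n * airy_integrand t (Complex 1 \<sigma>)) \<partial>lborel)"
    unfolding airy_moment_def by (rule integral_norm_bound)
  also have "\<dots> = (\<integral>\<sigma>. norm (Complex 1 \<sigma>) ^ n * exp (1/3 - \<sigma>\<^sup>2) * exp (- t) \<partial>lborel)"
    by (simp add: norm_mult norm_power norm_airy_integrand mult.assoc flip: exp_add)
  finally show ?thesis by simp
qed

lemma airy_moment_has_vector_derivative:
  "(airy_moment n has_vector_derivative - airy_moment (Suc n) t) (at t)"
proof -
  let ?f = "\<lambda>n t \<sigma>. Complex 1 \<sigma> ^ n * airy_integrand t (Complex 1 \<sigma>)"
  have "((\<lambda>t. \<integral>\<sigma>. ?f n t \<sigma> \<partial>lborel) has_vector_derivative (\<integral>\<sigma>. - ?f (Suc n) t \<sigma> \<partial>lborel)) (at t)"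
  proof (rule has_vector_derivative_integral_gauss_bounded)
    show "((\<lambda>y. ?f n y \<sigma>) has_vector_derivative - ?f (Suc n) y \<sigma>) (at y)" for y \<sigma>
    proof -
      have "((\<lambda>w. Complex 1 \<sigma> ^ n * exp (Complex 1 \<sigma> ^ 3 / 3 - Complex 1 \<sigma> * w)) has_field_derivative
          - (Complex 1 \<sigma> ^ Suc n * exp (Complex 1 \<sigma> ^ 3 / 3 - Complex 1 \<sigma> * of_real y))) (at (of_real y))"
        by (auto intro!: derivative_eq_intros)
      from has_vector_derivative_real_field[OF this] show ?thesis
        by (simp add: airy_integrand_def)
    qed
    show "gauss_bounded 1 A (\<lambda>y \<sigma>. - ?f (Suc n) y \<sigma>)" if "bounded A" for A
      using gauss_bounded_airy_line[OF that, of 1 "Suc n"] by (simp add: gauss_bounded_def)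
  qed (auto intro!: gauss_bounded_airy_line continuous_on_airy_line continuous_on_minus simp del: power_Suc)
  then show ?thesis
    by (simp only: airy_moment_def[abs_def] integral_minus)
qed

lemma airy_moment_recurrence:
  "airy_moment (n + 2) t = of_real t * airy_moment n t - of_nat n * airy_moment (n - 1) t"
proof -
  let ?f = "\<lambda>n \<sigma>. Complex 1 \<sigma> ^ n * airy_integrand t (Complex 1 \<sigma>)"
  let ?g = "\<lambda>\<sigma>. of_nat n * ?f (n - 1) \<sigma> + (?f (n + 2) \<sigma> - of_real t * ?f n \<sigma>)"
  note int = integrable_airy_line[OF zero_less_one]
  have lim: "((\<lambda>\<sigma>. - \<i> * ?f n \<sigma>) \<longlongrightarrow> 0) F" if "F = at_top \<or> F = at_bot" for F
    using gauss_bounded_tendsto_0[OF _ gauss_bounded_airy_line[of "{t}" 1 n] _ that]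
    by (intro tendsto_mult_right_zero) simp
  have "(\<integral>\<sigma>. ?g \<sigma> \<partial>lborel) = 0 - 0"
  proof (rule integral_FTC_real_line)
    show "((\<lambda>\<sigma>. - \<i> * ?f n \<sigma>) has_vector_derivative ?g \<sigma>) (at \<sigma>)" for \<sigma>
    proof -
      have "((\<lambda>z. z ^ n * airy_integrand t z) has_field_derivative
          of_nat n * (z ^ (n - 1) * airy_integrand t z) +
            (z ^ (n + 2) * airy_integrand t z - of_real t * (z ^ n * airy_integrand t z))) (at z)" for z
        by (rule derivative_eq_intros airy_integrand_has_field_derivative refl)+
          (simp add: algebra_simps power_add power2_eq_square)
      from has_vector_derivative_mult_right[OF
          field_vector_diff_chain_at[OF has_vector_derivative_Complex_Im this], of "- \<i>"]
      show ?thesis by (simp add: o_def algebra_simps)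
    qed
    show "continuous_on UNIV ?g"
      by (intro continuous_intros continuous_on_airy_line)
    show "integrable lborel ?g"
      by (intro Bochner_Integration.integrable_add Bochner_Integration.integrable_diff
          integrable_mult_right int)
  qed (use lim in auto)
  moreover have "(\<integral>\<sigma>. ?g \<sigma> \<partial>lborel) =
      of_nat n * airy_moment (n - 1) t + (airy_moment (n + 2) t - of_real t * airy_moment n t)"
    unfolding airy_moment_def
    by (simp only: Bochner_Integration.integral_add Bochner_Integration.integral_diff integral_mult_right_zero
        Bochner_Integration.integrable_diff integrable_mult_right int)
  ultimately show ?thesis
    by (simp add: algebra_simps)
qed

definition Airy_Ai' :: "real \<Rightarrow> real" where
  "Airy_Ai' t = - Re (airy_moment 1 t) / (2 * pi)"

lemma Airy_Ai_eq_moment: "Airy_Ai t = Re (airy_moment 0 t) / (2 * pi)"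
  by (simp add: Airy_Ai_eq_line_integral[of 1] airy_moment_def)

lemma Re_airy_moment_has_real_derivative:
  "((\<lambda>t. Re (airy_moment n t) / (2 * pi)) has_real_derivative - Re (airy_moment (Suc n) t) / (2 * pi)) (at t)"
  unfolding has_real_derivative_iff_has_vector_derivative
  using has_vector_derivative_divide[OF bounded_linear.has_vector_derivative[OF bounded_linear_Re
        airy_moment_has_vector_derivative[of n t]], of "2 * pi"] by simp

lemma Airy_Ai_has_real_derivative: "(Airy_Ai has_real_derivative Airy_Ai' t) (at t)"
  using Re_airy_moment_has_real_derivative[of 0] by (simp add: Airy_Ai_eq_moment[abs_def] Airy_Ai'_def)

lemma Airy_Ai'_has_real_derivative: "(Airy_Ai' has_real_derivative t * Airy_Ai t) (at t)"
  using DERIV_minus[OF Re_airy_moment_has_real_derivative[of 1 t]] airy_moment_recurrence[of 0 t]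
  by (simp add: Airy_Ai_eq_moment Airy_Ai'_def[abs_def] numeral_2_eq_2)

lemma continuous_on_Airy_Ai [continuous_intros]:
  "continuous_on S f \<Longrightarrow> continuous_on S (\<lambda>s. Airy_Ai (f s))"
  by (rule continuous_on_compose2[of UNIV])
    (auto intro: DERIV_continuous_on DERIV_subset Airy_Ai_has_real_derivative)

lemma continuous_on_Airy_Ai' [continuous_intros]:
  "continuous_on S f \<Longrightarrow> continuous_on S (\<lambda>s. Airy_Ai' (f s))"
  by (rule continuous_on_compose2[of UNIV])
    (auto intro: DERIV_continuous_on DERIV_subset Airy_Ai'_has_real_derivative)

lemma abs_Re_airy_moment_le:
  obtains C where "C \<ge> 0" "\<And>t. \<bar>Re (airy_moment n t) / (2 * pi)\<bar> \<le> C * exp (- t)"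
proof
  define B where "B = (\<integral>\<sigma>. norm (Complex 1 \<sigma>) ^ n * exp (1/3 - \<sigma>\<^sup>2) \<partial>lborel)"
  show "0 \<le> B / (2 * pi)"
    by (simp add: B_def)
  have "\<bar>Re (airy_moment n t)\<bar> \<le> B * exp (- t)" for t
    unfolding B_def using abs_Re_le_cmod norm_airy_moment_le by (rule order_trans)
  then show "\<bar>Re (airy_moment n t) / (2 * pi)\<bar> \<le> B / (2 * pi) * exp (- t)" for t
    by (simp add: divide_right_mono)
qed

subsection \<open>Asymptotics and positivity of the Airy function\<close>

definition airy_modulation :: "real \<Rightarrow> real \<Rightarrow> real" where
  "airy_modulation c t = gaussian_mean 1 (\<lambda>u. cos (u * ((c\<^sup>2 - t) / sqrt c) - u ^ 3 / (3 * c * sqrt c)))"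

text \<open>The line \<open>Re \<zeta> = c\<close>, parametrised in units of \<open>1 / sqrt c\<close>. For \<open>c\<^sup>2 = t\<close> it is the line of
  steepest descent; a free \<open>c\<close> makes the exponential prefactor exactly that of the eigenfunctions.\<close>

lemma Airy_Ai_eq_modulation:
  assumes "c > 0"
  shows "Airy_Ai t = exp (c ^ 3 / 3 - c * t) / (2 * sqrt (pi * c)) * airy_modulation c t"
proof -
  let ?h = "\<lambda>\<sigma>. cos (\<sigma> * (c\<^sup>2 - t) - \<sigma> ^ 3 / 3)"
  have "Re (airy_integrand t (Complex c \<sigma>)) = exp (c ^ 3 / 3 - c * t) * (exp (- c * \<sigma>\<^sup>2) * ?h \<sigma>)" for \<sigma>
    by (simp add: airy_integrand_def Re_exp power3_eq_cube power2_eq_square mult.assoc[symmetric]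
          flip: exp_add)
      (simp add: field_simps)
  then have "Re (\<integral>\<sigma>. airy_integrand t (Complex c \<sigma>) \<partial>lborel) =
      exp (c ^ 3 / 3 - c * t) * (\<integral>\<sigma>. exp (- c * \<sigma>\<^sup>2) * ?h \<sigma> \<partial>lborel)"
    using integral_Re[OF integrable_airy_line[OF assms, of 0 t]] by simp
  then have "Airy_Ai t = exp (c ^ 3 / 3 - c * t) / (2 * pi) * (\<integral>\<sigma>. exp (- c * \<sigma>\<^sup>2) * ?h \<sigma> \<partial>lborel)"
    by (simp add: Airy_Ai_eq_line_integral[OF assms])
  also have "\<dots> = exp (c ^ 3 / 3 - c * t) / (2 * sqrt (pi * c)) * gaussian_mean c ?h"
  proof -
    have "sqrt (c / pi) / sqrt (pi * c) = 1 / pi"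
      using assms by (simp add: real_sqrt_divide real_sqrt_mult)
    then show ?thesis by (simp add: gaussian_mean_def field_simps)
  qed
  also have "gaussian_mean c ?h = gaussian_mean 1 (\<lambda>u. ?h (u / sqrt c))"
    using gaussian_mean_rescale[of "sqrt c" 1 ?h] assms by simp
  also have "\<dots> = airy_modulation c t"
    using assms by (simp add: airy_modulation_def power_divide power3_eq_cube[of "sqrt c"] mult_ac)
  finally show ?thesis .
qed

lemma abs_airy_modulation_le: "\<bar>airy_modulation c t\<bar> \<le> 1"
  unfolding airy_modulation_def by (rule abs_gaussian_mean_le) auto

lemma borel_measurable_airy_modulation [measurable]: "airy_modulation c \<in> borel_measurable borel"
  unfolding airy_modulation_def by measurable

lemma tendsto_airy_modulation:
  fixes c t :: "real \<Rightarrow> real"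
  assumes c: "filterlim c at_top at_top" and t: "((\<lambda>y. ((c y)\<^sup>2 - t y) / sqrt (c y)) \<longlongrightarrow> 0) at_top"
  shows "((\<lambda>y. airy_modulation (c y) (t y)) \<longlongrightarrow> 1) at_top"
proof -
  have "((\<lambda>y. airy_modulation (c y) (t y)) \<longlongrightarrow> gaussian_mean 1 (\<lambda>u. 1)) at_top"
    unfolding airy_modulation_def
  proof (rule tendsto_gaussian_mean[where C = 1])
    fix u :: real
    have "((\<lambda>c::real. u ^ 3 / (3 * c * sqrt c)) \<longlongrightarrow> 0) at_top"
      by real_asymp
    from filterlim_compose[OF this c]
    have "((\<lambda>y. cos (u * (((c y)\<^sup>2 - t y) / sqrt (c y)) - u ^ 3 / (3 * c y * sqrt (c y))))
        \<longlongrightarrow> cos (u * 0 - 0)) at_top"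
      by (intro tendsto_intros t)
    then show "((\<lambda>y. cos (u * (((c y)\<^sup>2 - t y) / sqrt (c y)) - u ^ 3 / (3 * c y * sqrt (c y)))) \<longlongrightarrow> 1) at_top"
      by simp
  qed (auto intro: always_eventually)
  then show ?thesis by (simp add: gaussian_mean_const)
qed

lemma eventually_Airy_Ai_pos: "eventually (\<lambda>t. Airy_Ai t > 0) at_top"
proof -
  have "((\<lambda>t. airy_modulation (sqrt t) t) \<longlongrightarrow> 1) at_top"
  proof (rule tendsto_airy_modulation[OF sqrt_at_top])
    have "eventually (\<lambda>t. ((sqrt t)\<^sup>2 - t) / sqrt (sqrt t) = 0) at_top"
      using eventually_ge_at_top[of 0] by eventually_elim simp
    then show "((\<lambda>t. ((sqrt t)\<^sup>2 - t) / sqrt (sqrt t)) \<longlongrightarrow> 0) at_top"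
      by (rule tendsto_eventually)
  qed
  then have "eventually (\<lambda>t. airy_modulation (sqrt t) t > 0) at_top"
    by (rule order_tendstoD) simp
  then show ?thesis
    using eventually_gt_at_top[of 0]
    by eventually_elim (simp add: Airy_Ai_eq_modulation[of "sqrt t" t for t])
qed

text \<open>Existence of a zero is not needed: without one, \<open>airy_a1\<close> is an arbitrary real, but then the
  intermediate value theorem already gives positivity everywhere.\<close>

proposition Airy_Ai_pos:
  assumes "t > airy_a1"
  shows "Airy_Ai t > 0"
proof (rule ccontr)
  assume not_pos: "\<not> Airy_Ai t > 0"
  let ?Z = "{s. Airy_Ai s = 0}"
  obtain B where B: "\<And>s. s \<ge> B \<Longrightarrow> Airy_Ai s > 0"
    using eventually_Airy_Ai_pos by (auto simp: eventually_at_top_linorder)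
  then have "t \<le> B"
    using not_pos linear by blast
  then obtain s where s: "t \<le> s" "Airy_Ai s = 0"
    using IVT'[of Airy_Ai t 0 B] not_pos B[of B] continuous_on_Airy_Ai[OF continuous_on_id] by force
  have "r \<le> B" if "Airy_Ai r = 0" for r
    using B[of r] that by linarith
  then have bdd: "bdd_above ?Z"
    by (intro bdd_aboveI[of _ B]) simp
  have "closed ?Z"
    using continuous_closed_preimage_constant[of UNIV Airy_Ai 0] continuous_on_Airy_Ai[OF continuous_on_id]
    by simp
  then have "Sup ?Z \<in> ?Z"
    using s(2) bdd by (intro closed_contains_Sup) auto
  moreover have Sup_upper: "r \<le> Sup ?Z" if "Airy_Ai r = 0" for r
    using bdd that by (intro cSup_upper) auto
  ultimately have "airy_a1 = Sup ?Z"
    unfolding airy_a1_def by (intro Greatest_equality) auto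
  then show False
    using Sup_upper[OF s(2)] s(1) assms by linarith
qed

subsection \<open>The kernel\<close>

locale quartic_potential =
  fixes a lam :: real
  assumes lam_pos: "lam > 0"
begin

definition b :: real where
  "b = lam powr (1/6) / sqrt 2"

lemma b_pos: "b > 0"
  using lam_pos by (simp add: b_def)

lemma b_power: "b ^ (2 * n) = lam powr (n / 3) / 2 ^ n"
proof -
  have "(lam powr (1/6)) ^ (2 * n) = lam powr (n / 3)"
    using lam_pos by (simp add: powr_powr flip: powr_realpow)
  then show ?thesis
    by (simp add: b_def power_divide power_mult[of "sqrt 2"])
qed

lemma lam_powr_eq: "lam powr (1/3) = 2 * b\<^sup>2" "lam powr (2/3) = 4 * b ^ 4" "lam / 2 = 4 * b ^ 6"
  using b_power[of 1] b_power[of 2] b_power[of 3] lam_pos by simp_all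

lemma sqrt_half_lam: "sqrt (lam / 2) = 2 * b ^ 3"
proof -
  have "sqrt (lam / 2) = sqrt ((2 * b ^ 3)\<^sup>2)"
    by (simp only: lam_powr_eq(3)) (simp add: power_mult_distrib)
  also have "\<dots> = 2 * b ^ 3"
    using b_pos by (simp only: real_sqrt_abs) simp
  finally show ?thesis .
qed

definition potential :: "real \<Rightarrow> real" where
  "potential x = a * x\<^sup>2 + lam / 2 * x ^ 4"

lemma potential_eq: "potential x = a * x\<^sup>2 + 4 * b ^ 6 * x ^ 4"
  by (simp only: potential_def lam_powr_eq(3))

definition airy_arg :: "real \<Rightarrow> real \<Rightarrow> real \<Rightarrow> real" where
  "airy_arg x y z = b\<^sup>2 * (x\<^sup>2 + y\<^sup>2 + z\<^sup>2) + a / (4 * b ^ 4)"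

abbreviation K :: "real \<Rightarrow> real \<Rightarrow> real \<Rightarrow> real" where
  "K \<equiv> quartic_kernel a lam"

text \<open>Both derivatives are taken in the last argument; as the kernel is symmetric, \<open>K' x z y\<close> is the
  derivative of \<open>K x y z\<close> in \<open>y\<close>.\<close>

definition K' :: "real \<Rightarrow> real \<Rightarrow> real \<Rightarrow> real" where
  "K' x y z = 2 * b\<^sup>2 * exp (2 * b ^ 3 * x * y * z) *
     (2 * b ^ 3 * x * y * Airy_Ai (airy_arg x y z) + 2 * b\<^sup>2 * z * Airy_Ai' (airy_arg x y z))"

definition K'' :: "real \<Rightarrow> real \<Rightarrow> real \<Rightarrow> real" where
  "K'' x y z = 2 * b\<^sup>2 * exp (2 * b ^ 3 * x * y * z) *
     ((4 * b ^ 6 * x\<^sup>2 * y\<^sup>2 + 4 * b ^ 4 * z\<^sup>2 * airy_arg x y z) * Airy_Ai (airy_arg x y z) +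
      (8 * b ^ 5 * x * y * z + 2 * b\<^sup>2) * Airy_Ai' (airy_arg x y z))"

lemma K_eq: "K x y z = 2 * b\<^sup>2 * exp (2 * b ^ 3 * x * y * z) * Airy_Ai (airy_arg x y z)"
  by (simp add: quartic_kernel_def airy_arg_def lam_powr_eq(1,2) sqrt_half_lam)

lemma airy_arg_commute: "airy_arg x z y = airy_arg x y z"
  by (simp add: airy_arg_def algebra_simps)

lemma K_commute: "K x z y = K x y z"
  by (simp add: K_eq airy_arg_commute mult.commute mult.left_commute)

lemma airy_arg_has_real_derivative: "((\<lambda>z. airy_arg x y z) has_real_derivative 2 * b\<^sup>2 * z) (at z)"
  unfolding airy_arg_def by (auto intro!: derivative_eq_intros)

lemmas Airy_Ai_airy_arg_has_real_derivative =
  DERIV_chain2[OF Airy_Ai_has_real_derivative airy_arg_has_real_derivative]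
  DERIV_chain2[OF Airy_Ai'_has_real_derivative airy_arg_has_real_derivative]

lemma K_has_real_derivative: "((\<lambda>z. K x y z) has_real_derivative K' x y z) (at z)"
  unfolding K_eq K'_def
  by (rule derivative_eq_intros Airy_Ai_airy_arg_has_real_derivative refl)+ (simp add: algebra_simps)

lemma K'_has_real_derivative: "((\<lambda>z. K' x y z) has_real_derivative K'' x y z) (at z)"
  unfolding K'_def K''_def
  by (rule derivative_eq_intros Airy_Ai_airy_arg_has_real_derivative refl)+
    (simp add: algebra_simps power_numeral_reduce)

lemma K_partial_differential_equation:
  "K'' x z y = K'' x y z + (potential y - potential z) * K x y z"
  using b_pos
  by (simp add: K''_def K_eq potential_eq airy_arg_commute airy_arg_def field_simps power_numeral_reduce)

lemma continuous_on_potential [continuous_intros]: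
  "continuous_on S f \<Longrightarrow> continuous_on S (\<lambda>s. potential (f s))"
  unfolding potential_def by (intro continuous_intros)

lemma continuous_on_airy_arg [continuous_intros]:
  "continuous_on S f \<Longrightarrow> continuous_on S g \<Longrightarrow> continuous_on S (\<lambda>s. airy_arg x (f s) (g s))"
  unfolding airy_arg_def by (intro continuous_intros)

lemma continuous_on_K [continuous_intros]:
  assumes "continuous_on S f" "continuous_on S g"
  shows "continuous_on S (\<lambda>s. K x (f s) (g s))" "continuous_on S (\<lambda>s. K' x (f s) (g s))"
    "continuous_on S (\<lambda>s. K'' x (f s) (g s))"
  unfolding K_eq K'_def K''_def by (intro continuous_intros assms)+

lemma exp_bounded_potential [gauss_bounded_intros]: "exp_bounded A (\<lambda>y z. potential z)"
  unfolding potential_def by (intro gauss_bounded_intros)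

lemma exp_bounded_airy_arg [gauss_bounded_intros]:
  "bounded A \<Longrightarrow> exp_bounded A (\<lambda>y z. airy_arg x y z)"
  unfolding airy_arg_def by (intro gauss_bounded_intros)

lemma gauss_bounded_comp_airy_arg:
  assumes "C \<ge> 0" and decay: "\<And>t. \<bar>h t\<bar> \<le> C * exp (- t)"
  shows "gauss_bounded (b\<^sup>2) A (\<lambda>y z. h (airy_arg x y z))"
proof (rule gauss_boundedI)
  fix y z
  have "0 \<le> b\<^sup>2 * x\<^sup>2" "0 \<le> b\<^sup>2 * y\<^sup>2"
    by simp_all
  then have "exp (- airy_arg x y z) \<le> exp (- a / (4 * b ^ 4) + (0 * \<bar>z\<bar> - b\<^sup>2 * z\<^sup>2))"
    unfolding airy_arg_def distrib_left minus_divide_left[symmetric] exp_le_cancel_iff by linarith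
  then have "C * exp (- airy_arg x y z) \<le> C * exp (- a / (4 * b ^ 4) + (0 * \<bar>z\<bar> - b\<^sup>2 * z\<^sup>2))"
    using assms(1) by (rule mult_left_mono)
  also have "\<dots> = C * exp (- a / (4 * b ^ 4)) * exp (0 * \<bar>z\<bar> - b\<^sup>2 * z\<^sup>2)"
    by (simp only: exp_add mult.assoc)
  finally show "norm (h (airy_arg x y z)) \<le> C * exp (- a / (4 * b ^ 4)) * exp (0 * \<bar>z\<bar> - b\<^sup>2 * z\<^sup>2)"
    using decay[of "airy_arg x y z"] by simp
qed

lemma gauss_bounded_Airy_Ai_airy_arg [gauss_bounded_intros]:
  "gauss_bounded (b\<^sup>2) A (\<lambda>y z. Airy_Ai (airy_arg x y z))"
  "gauss_bounded (b\<^sup>2) A (\<lambda>y z. Airy_Ai' (airy_arg x y z))"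
proof -
  show "gauss_bounded (b\<^sup>2) A (\<lambda>y z. Airy_Ai (airy_arg x y z))"
    by (rule abs_Re_airy_moment_le[of 0], rule gauss_bounded_comp_airy_arg)
      (simp_all add: Airy_Ai_eq_moment)
  show "gauss_bounded (b\<^sup>2) A (\<lambda>y z. Airy_Ai' (airy_arg x y z))"
    by (rule abs_Re_airy_moment_le[of 1], rule gauss_bounded_comp_airy_arg)
      (simp_all add: Airy_Ai'_def)
qed

lemma gauss_bounded_K [gauss_bounded_intros]:
  assumes "bounded A"
  shows "gauss_bounded (b\<^sup>2) A (\<lambda>y z. K x y z)" "gauss_bounded (b\<^sup>2) A (\<lambda>y z. K' x y z)"
    "gauss_bounded (b\<^sup>2) A (\<lambda>y z. K'' x y z)" "gauss_bounded (b\<^sup>2) A (\<lambda>y z. K' x z y)"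
    "gauss_bounded (b\<^sup>2) A (\<lambda>y z. K'' x z y)"
proof -
  show "gauss_bounded (b\<^sup>2) A (\<lambda>y z. K x y z)" "gauss_bounded (b\<^sup>2) A (\<lambda>y z. K' x y z)"
    "gauss_bounded (b\<^sup>2) A (\<lambda>y z. K'' x y z)"
    unfolding K_eq K'_def K''_def by (intro gauss_bounded_intros assms)+
  have K'_commuted: "K' x z y = 2 * b\<^sup>2 * exp (2 * b ^ 3 * x * y * z) *
      (2 * b ^ 3 * x * z * Airy_Ai (airy_arg x y z) + 2 * b\<^sup>2 * y * Airy_Ai' (airy_arg x y z))" for y z
    by (simp add: K'_def airy_arg_commute[of x z y] mult_ac)
  have K''_commuted: "K'' x z y = 2 * b\<^sup>2 * exp (2 * b ^ 3 * x * y * z) *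
      ((4 * b ^ 6 * x\<^sup>2 * z\<^sup>2 + 4 * b ^ 4 * y\<^sup>2 * airy_arg x y z) * Airy_Ai (airy_arg x y z) +
        (8 * b ^ 5 * x * y * z + 2 * b\<^sup>2) * Airy_Ai' (airy_arg x y z))" for y z
    by (simp add: K''_def airy_arg_commute[of x z y] mult_ac)
  show "gauss_bounded (b\<^sup>2) A (\<lambda>y z. K' x z y)" "gauss_bounded (b\<^sup>2) A (\<lambda>y z. K'' x z y)"
    unfolding K'_commuted K''_commuted by (intro gauss_bounded_intros assms)+
qed

lemma integrable_exp_bounded_mult_K:
  assumes "exp_bounded {y} (\<lambda>y. f)" "continuous_on UNIV f"
  shows "integrable lborel (\<lambda>z. f z * K x y z)" "integrable lborel (\<lambda>z. f z * K'' x y z)"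
  using b_pos
  by (intro gauss_bounded_integrable[of "b\<^sup>2" "{y}" "\<lambda>y z. f z * K x y z"]
      gauss_bounded_integrable[of "b\<^sup>2" "{y}" "\<lambda>y z. f z * K'' x y z"]
      gauss_bounded_mult gauss_bounded_K continuous_intros assms; simp)+

lemma K_pos:
  assumes "a > lam powr (2/3) * airy_a1"
  shows "K x y z > 0"
proof -
  have "airy_a1 < a / (4 * b ^ 4)"
    using assms b_pos unfolding lam_powr_eq(2) by (simp add: field_simps)
  also have "\<dots> \<le> airy_arg x y z"
    by (simp add: airy_arg_def)
  finally show ?thesis
    using b_pos Airy_Ai_pos by (simp add: K_eq)
qed

subsection \<open>The kernel as an approximate identity\<close>

definition profile :: "real \<Rightarrow> real" where
  "profile y = inverse y * exp (- (sqrt (lam/2) / 3) * y ^ 3 - a / (2 * sqrt (lam/2)) * y)"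

lemma profile_pos: "y > 0 \<Longrightarrow> profile y > 0"
  by (simp add: profile_def)

lemma K_eq_profile:
  assumes y: "y > 0"
  shows "K x y z = profile y * (sqrt (b ^ 3 * y / pi) *
    (exp (- (b ^ 3 * y) * (z - x)\<^sup>2) * airy_modulation (b * y) (airy_arg x y z)))"
proof -
  have "2 * b ^ 3 * x * y * z + ((b * y) ^ 3 / 3 - b * y * airy_arg x y z) =
      (- (2 * b ^ 3 / 3) * y ^ 3 - a / (4 * b ^ 3) * y) + (- (b ^ 3 * y) * (z - x)\<^sup>2)"
    unfolding airy_arg_def using b_pos by (simp add: field_simps power_numeral_reduce)
  moreover have "y * profile y = exp (- (2 * b ^ 3 / 3) * y ^ 3 - a / (4 * b ^ 3) * y)"
    using y by (simp add: profile_def sqrt_half_lam)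
  ultimately have exponent: "exp (2 * b ^ 3 * x * y * z) * exp ((b * y) ^ 3 / 3 - b * y * airy_arg x y z) =
      y * profile y * exp (- (b ^ 3 * y) * (z - x)\<^sup>2)"
    by (simp only: exp_add[symmetric])
  have prefactor: "2 * b\<^sup>2 / (2 * sqrt (pi * (b * y))) * y = sqrt (b ^ 3 * y / pi)"
  proof (rule real_sqrt_unique[symmetric])
    show "(2 * b\<^sup>2 / (2 * sqrt (pi * (b * y))) * y)\<^sup>2 = b ^ 3 * y / pi"
      using b_pos y by (simp add: power_mult_distrib power_divide power_numeral_reduce)
  qed (use b_pos y in simp)
  have "K x y z = 2 * b\<^sup>2 / (2 * sqrt (pi * (b * y))) *
      (exp (2 * b ^ 3 * x * y * z) * exp ((b * y) ^ 3 / 3 - b * y * airy_arg x y z)) *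
      airy_modulation (b * y) (airy_arg x y z)"
    using b_pos y by (simp add: K_eq Airy_Ai_eq_modulation[of "b * y"])
  then show ?thesis
    unfolding exponent prefactor[symmetric] by (simp only: mult_ac)
qed

lemma integral_K_eq_gaussian_mean:
  assumes y: "y > 0"
  shows "(\<integral>z. f z * K x y z \<partial>lborel) = profile y *
    gaussian_mean (b ^ 3) (\<lambda>u. f (x + u / sqrt y) * airy_modulation (b * y) (airy_arg x y (x + u / sqrt y)))"
proof -
  define h where "h v = f (x + v) * airy_modulation (b * y) (airy_arg x y (x + v))" for v
  have "(\<integral>z. f z * K x y z \<partial>lborel) = \<bar>1\<bar> *\<^sub>R (\<integral>v. f (x + 1 * v) * K x y (x + 1 * v) \<partial>lborel)"
    by (rule lborel_integral_real_affine) simp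
  also have "\<dots> = (\<integral>v. profile y * sqrt (b ^ 3 * y / pi) * (exp (- (b ^ 3 * y) * v\<^sup>2) * h v) \<partial>lborel)"
    by (simp add: K_eq_profile[OF y] h_def mult_ac)
  also have "\<dots> = profile y * gaussian_mean (b ^ 3 * (sqrt y)\<^sup>2) h"
    using y by (simp add: gaussian_mean_def)
  also have "gaussian_mean (b ^ 3 * (sqrt y)\<^sup>2) h = gaussian_mean (b ^ 3) (\<lambda>u. h (u / sqrt y))"
    using y by (intro gaussian_mean_rescale) simp
  finally show ?thesis by (simp only: h_def)
qed

lemma tendsto_airy_modulation_airy_arg:
  "((\<lambda>y. airy_modulation (b * y) (airy_arg x y (x + u / sqrt y))) \<longlongrightarrow> 1) at_top"
proof (rule tendsto_airy_modulation)
  show "filterlim (\<lambda>y. b * y) at_top at_top"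
    using b_pos by real_asymp
  have "((\<lambda>y. u / sqrt y) \<longlongrightarrow> 0) at_top" "((\<lambda>y. 1 / sqrt (b * y)) \<longlongrightarrow> 0) at_top"
    using b_pos by real_asymp+
  then have "((\<lambda>y. - (b\<^sup>2 * (x\<^sup>2 + (x + u / sqrt y)\<^sup>2) + a / (4 * b ^ 4)) * (1 / sqrt (b * y))) \<longlongrightarrow>
      - (b\<^sup>2 * (x\<^sup>2 + (x + 0)\<^sup>2) + a / (4 * b ^ 4)) * 0) at_top"
    by (intro tendsto_intros)
  then show "((\<lambda>y. ((b * y)\<^sup>2 - airy_arg x y (x + u / sqrt y)) / sqrt (b * y)) \<longlongrightarrow> 0) at_top"
    by (simp add: airy_arg_def power_mult_distrib algebra_simps add_divide_distrib diff_divide_distrib)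
qed

proposition tendsto_integral_K_div_profile:
  assumes cont: "isCont f x" and meas: "f \<in> borel_measurable borel" and bounded: "bounded (range f)"
  shows "((\<lambda>y. (\<integral>z. f z * K x y z \<partial>lborel) / profile y) \<longlongrightarrow> f x) at_top"
proof -
  let ?h = "\<lambda>y u. f (x + u / sqrt y) * airy_modulation (b * y) (airy_arg x y (x + u / sqrt y))"
  obtain C where C: "\<And>z. \<bar>f z\<bar> \<le> C"
    using bounded unfolding bounded_iff by auto
  have b_cubed_pos: "b ^ 3 > 0" using b_pos by simp
  have "((\<lambda>y. gaussian_mean (b ^ 3) (?h y)) \<longlongrightarrow> gaussian_mean (b ^ 3) (\<lambda>u. f x)) at_top"
  proof (rule tendsto_gaussian_mean[OF b_cubed_pos])
    show "?h y \<in> borel_measurable borel" for y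
      using meas unfolding airy_arg_def by measurable
    have "\<bar>?h y u\<bar> \<le> C" for y u
      using mult_mono[OF C abs_airy_modulation_le order_trans[OF abs_ge_zero C] abs_ge_zero]
      by (simp add: abs_mult)
    then show "eventually (\<lambda>y. \<forall>u. \<bar>?h y u\<bar> \<le> C) at_top"
      by simp
    fix u :: real
    have "((\<lambda>y. u / sqrt y) \<longlongrightarrow> 0) at_top" by real_asymp
    from tendsto_add[OF tendsto_const this] have "((\<lambda>y. x + u / sqrt y) \<longlongrightarrow> x) at_top"
      by simp
    from tendsto_mult[OF isCont_tendsto_compose[OF cont this] tendsto_airy_modulation_airy_arg]
    show "((\<lambda>y. ?h y u) \<longlongrightarrow> f x) at_top" by simp
  qed simp
  moreover have "eventually (\<lambda>y. gaussian_mean (b ^ 3) (?h y) =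
      (\<integral>z. f z * K x y z \<partial>lborel) / profile y) at_top"
    using eventually_gt_at_top[of 0]
    by eventually_elim (simp add: integral_K_eq_gaussian_mean profile_pos[THEN less_imp_not_eq2])
  ultimately show ?thesis
    using Lim_transform_eventually gaussian_mean_const[OF b_cubed_pos] by force
qed

end

subsection \<open>Eigenfunctions\<close>

locale quartic_eigenfunction = quartic_potential +
  fixes E :: real and \<psi> \<psi>' :: "real \<Rightarrow> real"
  assumes \<psi>_has_real_derivative: "\<And>x. (\<psi> has_real_derivative \<psi>' x) (at x)"
    and \<psi>'_has_real_derivative: "\<And>x. (\<psi>' has_real_derivative (potential x - E) * \<psi> x) (at x)"
    and \<psi>_tendsto_0: "(\<psi> \<longlongrightarrow> 0) at_top" "(\<psi> \<longlongrightarrow> 0) at_bot"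
    and \<psi>_asymp_equiv: "\<psi> \<sim>[at_top] profile"
begin

lemma continuous_on_\<psi> [continuous_intros]: "continuous_on S \<psi>" "continuous_on S \<psi>'"
  by (auto intro!: DERIV_continuous_on DERIV_subset[OF \<psi>_has_real_derivative]
      DERIV_subset[OF \<psi>'_has_real_derivative])

lemma bounded_range_\<psi>: "bounded (range \<psi>)"
  using continuous_on_\<psi>(1) \<psi>_tendsto_0 by (rule bounded_range_if_tendsto_at_top_at_bot)

lemma exp_bounded_\<psi> [gauss_bounded_intros]: "exp_bounded A (\<lambda>y z. \<psi> z)"
  using bounded_range_\<psi> by (rule exp_bounded_bounded) simp

lemma exp_bounded_\<psi>' [gauss_bounded_intros]: "exp_bounded A (\<lambda>y z. \<psi>' z)"
  by (rule exp_bounded_antiderivative[OF \<psi>'_has_real_derivative]) (intro gauss_bounded_intros)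

definition transform :: "real \<Rightarrow> real \<Rightarrow> real" where
  "transform x y = (\<integral>z. \<psi> z * K x y z \<partial>lborel)"

definition transform' :: "real \<Rightarrow> real \<Rightarrow> real" where
  "transform' x y = (\<integral>z. \<psi> z * K' x z y \<partial>lborel)"

lemma transform_has_real_derivative: "(transform x has_real_derivative transform' x y) (at y)"
  unfolding transform_def[abs_def] transform'_def
proof (rule has_real_derivative_integral_mult_gauss_bounded[where r = "b\<^sup>2"])
  show "((\<lambda>y. K x y z) has_real_derivative K' x z y) (at y)" for y z
    using K_has_real_derivative[of x z y] by (simp only: K_commute)
qed (use b_pos in simp, (intro gauss_bounded_intros continuous_intros; assumption?)+)

lemma integral_\<psi>_K'': "(\<integral>z. \<psi> z * K'' x y z \<partial>lborel) = (\<integral>z. (potential z - E) * \<psi> z * K x y z \<partial>lborel)"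
proof (rule integral_second_derivative_symmetric)
  show "((\<lambda>z. \<psi> z * K' x y z) \<longlongrightarrow> 0) F" "((\<lambda>z. \<psi>' z * K x y z) \<longlongrightarrow> 0) F" if "F = at_top \<or> F = at_bot" for F
    using b_pos
    by (intro gauss_bounded_tendsto_0[of "b\<^sup>2" "{y}" "\<lambda>y z. \<psi> z * K' x y z"]
        gauss_bounded_tendsto_0[of "b\<^sup>2" "{y}" "\<lambda>y z. \<psi>' z * K x y z"] gauss_bounded_intros that; simp)+
qed (intro \<psi>_has_real_derivative \<psi>'_has_real_derivative K_has_real_derivative K'_has_real_derivative
    integrable_exp_bounded_mult_K gauss_bounded_intros continuous_intros)+

lemma transform'_has_real_derivative:
  "(transform' x has_real_derivative (potential y - E) * transform x y) (at y)"
proof -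
  have "(transform' x has_real_derivative (\<integral>z. \<psi> z * K'' x z y \<partial>lborel)) (at y)"
    unfolding transform'_def[abs_def]
    by (rule has_real_derivative_integral_mult_gauss_bounded[where r = "b\<^sup>2",
          OF _ _ _ _ _ _ _ K'_has_real_derivative])
      (use b_pos in simp, (intro gauss_bounded_intros continuous_intros; assumption?)+)
  moreover have "(\<integral>z. \<psi> z * K'' x z y \<partial>lborel) = (potential y - E) * transform x y"
  proof -
    have "\<psi> z * K'' x z y = \<psi> z * K'' x y z - (potential z - E) * \<psi> z * K x y z +
        (potential y - E) * (\<psi> z * K x y z)" for z
      unfolding K_partial_differential_equation[of x z y] by (simp add: algebra_simps)
    moreover have "integrable lborel (\<lambda>z. \<psi> z * K x y z)" "integrable lborel (\<lambda>z. \<psi> z * K'' x y z)"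
      "integrable lborel (\<lambda>z. (potential z - E) * \<psi> z * K x y z)"
      by (intro integrable_exp_bounded_mult_K gauss_bounded_intros continuous_intros)+
    ultimately show ?thesis
      by (simp add: integral_\<psi>_K'' transform_def)
  qed
  ultimately show ?thesis by simp
qed

theorem transform_eq_product: "transform x y = \<psi> x * \<psi> y"
proof (rule linear_ode_solution_eq_if_asymptotic[OF
      transform_has_real_derivative transform'_has_real_derivative
      \<psi>_has_real_derivative \<psi>'_has_real_derivative _ \<psi>_tendsto_0(1)])
  have eventually_profile_pos: "eventually (\<lambda>y. profile y > 0) at_top"
    using eventually_gt_at_top profile_pos by (rule eventually_mono)
  then have quotient: "((\<lambda>y. \<psi> y / profile y) \<longlongrightarrow> 1) at_top"
    using \<psi>_asymp_equiv by (intro asymp_equivD_strong) (auto elim: eventually_mono)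
  from order_tendstoD(1)[OF this zero_less_one]
  show "eventually (\<lambda>y. \<psi> y \<noteq> 0) at_top"
    by eventually_elim auto
  have "isCont \<psi> x"
    using \<psi>_has_real_derivative by (rule DERIV_isCont)
  then have "((\<lambda>y. transform x y / profile y) \<longlongrightarrow> \<psi> x) at_top"
    unfolding transform_def using bounded_range_\<psi>
    by (intro tendsto_integral_K_div_profile borel_measurable_continuous_onI continuous_on_\<psi>)
  from tendsto_divide[OF this quotient]
  have "((\<lambda>y. (transform x y / profile y) / (\<psi> y / profile y)) \<longlongrightarrow> \<psi> x) at_top"
    by simp
  moreover have "eventually (\<lambda>y. (transform x y / profile y) / (\<psi> y / profile y) =
      transform x y / \<psi> y) at_top"
    using eventually_profile_pos by eventually_elim simp
  ultimately show "((\<lambda>y. transform x y / \<psi> y) \<longlongrightarrow> \<psi> x) at_top"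
    by (rule Lim_transform_eventually)
qed (intro continuous_intros)

end

lemma (in quartic_potential) normalised_eigenfunctionE:
  assumes "normalised_eigenfunction a lam E \<psi>"
  obtains \<psi>' where "quartic_eigenfunction a lam E \<psi> \<psi>'"
  using assms quartic_potential_axioms
  unfolding normalised_eigenfunction_def quartic_eigenfunction_def quartic_eigenfunction_axioms_def
    potential_def profile_def[abs_def]
  by blast

theorem theorem1:
  fixes a lam :: real
  assumes "lam > 0"
  shows "(\<forall>E \<psi>. normalised_eigenfunction a lam E \<psi> \<longrightarrow>
            (\<forall>x y. integrable lborel (\<lambda>z. \<psi> z * quartic_kernel a lam x y z) \<and>
                   \<psi> x * \<psi> y = (\<integral>z. \<psi> z * quartic_kernel a lam x y z \<partial>lborel)))
       \<and> (a > lam powr (2/3) * airy_a1 \<longrightarrow> (\<forall>x y z. quartic_kernel a lam x y z > 0))"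
proof (intro conjI impI allI)
  interpret quartic_potential a lam
    using assms by unfold_locales
  show "quartic_kernel a lam x y z > 0" if "a > lam powr (2/3) * airy_a1" for x y z
    using that by (rule K_pos)
  fix E \<psi> x y
  assume "normalised_eigenfunction a lam E \<psi>"
  then obtain \<psi>' where "quartic_eigenfunction a lam E \<psi> \<psi>'"
    by (rule normalised_eigenfunctionE)
  then interpret quartic_eigenfunction a lam E \<psi> \<psi>' .
  show "integrable lborel (\<lambda>z. \<psi> z * quartic_kernel a lam x y z)"
    by (intro integrable_exp_bounded_mult_K exp_bounded_\<psi> continuous_on_\<psi>)
  show "\<psi> x * \<psi> y = (\<integral>z. \<psi> z * quartic_kernel a lam x y z \<partial>lborel)"
    by (simp only: transform_eq_product flip: transform_def)
qed

end
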